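(* The following three identities hold: \begin{align*} (q)_\infty \mathcal{F}_0(q) &=\sum_{j=1}^\infty \ \sum_{-j \le 3m \le j-1} \operatorname{sgn}(m) (-1)^{m+j+1} q^{ j(3j-1)/2 - m(21m+13)/2 -1}(1+q^{j})(1-q^{6m+1}),\\ (q)_\infty \mathcal{F}_1(q) &=\sum_{j=1}^\infty \ \sum_{-j \le 3m \le j-1} \operatorname{sgn}(m) (-1)^{m+j+1} q^{ j(3j-1)/2 - m(21m+5)/2}(1+q^{j})\\ &\quad+\sum_{j=2}^\infty \ \sum_{-j-1 \le 3m \le j-2} \operatorname{sgn}(m) (-1)^{m+j+1} q^{ j(3j-1)/2 - m(21m+19)/2 -2}(1+q^{j}),\\ (q)_\infty \mathcal{F}_2(q) &=\sum_{j=1}^\infty \ \sum_{-j \le 3m \le j-1} \operatorname{sgn}(m) (-1)^{m+j+1} q^{ j(3j-1)/2 - m(21m+11)/2 -1}(1+q^{j})\\ &\quad+\sum_{j=2}^\infty \ \sum_{-j-1 \le 3m \le j-2} \operatorname{sgn}(m) (-1)^{m+j+1} q^{ j(3j-1)/2 - m(21m+17)/2 -2}(1+q^{j}). \end{align*} In each inner sum $m$ ranges over all integers (possibly negative) satisfying the indicated inequalities.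
   Context: The identities are between power series in $q$ (formal, or convergent for $|q|<1$). Notation: for a nonnegative integer $n$, $(a;q)_n=(1-a)(1-aq)\cdots(1-aq^{n-1})$, and $(q)_\infty=\prod_{n=1}^\infty(1-q^n)$. Ramanujan's seventh order mock theta functions are $$\mathcal{F}_0(q)=\sum_{n=0}^\infty \frac{q^{n^2}}{(q^{n+1};q)_n},\qquad \mathcal{F}_1(q)=\sum_{n=1}^\infty \frac{q^{n^2}}{(q^{n};q)_n},\qquad \mathcal{F}_2(q)=\sum_{n=0}^\infty \frac{q^{n^2+n}}{(q^{n+1};q)_{n+1}}.$$ The sign function is $\operatorname{sgn}(m)=1$ if $m\ge 0$ and $\operatorname{sgn}(m)=-1$ if $m<0$. *)

theory Defs
  imports "HOL-Analysis.Analysis"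
begin

text \<open>
  The power series in \<open>q\<close> are read as convergent series for complex \<open>q\<close> with \<open>norm q < 1\<close>.
\<close>

definition qpoch :: "complex \<Rightarrow> complex \<Rightarrow> nat \<Rightarrow> complex" where
  "qpoch a q n = (\<Prod>k<n. 1 - a * q ^ k)"

definition qpoch_inf :: "complex \<Rightarrow> complex" where
  "qpoch_inf q = (\<Prod>n. 1 - q ^ Suc n)"

text \<open>Ramanujan's seventh order mock theta functions\<close>

definition mock_F0 :: "complex \<Rightarrow> complex" where
  "mock_F0 q = (\<Sum>\<^sub>\<infinity>n\<in>{0..}. q ^ (n\<^sup>2) / qpoch (q ^ (n + 1)) q n)"

definition mock_F1 :: "complex \<Rightarrow> complex" where
  "mock_F1 q = (\<Sum>\<^sub>\<infinity>n\<in>{1..}. q ^ (n\<^sup>2) / qpoch (q ^ n) q n)"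

definition mock_F2 :: "complex \<Rightarrow> complex" where
  "mock_F2 q = (\<Sum>\<^sub>\<infinity>n\<in>{0..}. q ^ (n\<^sup>2 + n) / qpoch (q ^ (n + 1)) q (n + 1))"

text \<open>Unlike the library function \<^const>\<open>sgn\<close>, this takes the value 1 at 0.\<close>

definition sg :: "int \<Rightarrow> complex" where
  "sg m = (if m \<ge> 0 then 1 else - 1)"

text \<open>
  The exponents in the theorem are integer expressions. The divisions by 2 are exact, so \<open>div\<close> does
  not round. The exponent of the leading power of \<open>q\<close> in each term is nonnegative on the range
  of summation, and in the first identity for \<open>m < 0\<close> so is its sum with \<open>6 * m + 1\<close>. In that last case both are
  positive, so with \<open>0 powi k = 0\<close> for \<open>k \<noteq> 0\<close> the terms also have the intended value at
  \<open>q = 0\<close>.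
\<close>

end

theory Submission
  imports Defs
begin

text \<open>
  Each of the three functions has the form \<open>\<Sum>n. q^n (q)_n \<beta>_n\<close>, where \<open>\<beta>_n\<close> is a power of
  \<open>q\<close> divided by \<open>(q)_{2n}\<close> or \<open>(q)_{2n+1}\<close>. Such a \<open>\<beta>_n\<close> is part of a Bailey pair
  relative to \<open>a = q\<close>, that is \<open>\<beta>_n = \<Sum>r\<le>n. \<alpha>_r / ((q)_{n-r} (q)_{n+r+1})\<close>, in which \<open>\<alpha>_r\<close>
  is made of powers of \<open>q\<close> with exponents quadratic in \<open>m\<close> for \<open>r\<close> near \<open>3 |m|\<close>. Cleared of
  denominators, these are identities between sums \<open>\<Sum>m. q^(3m^2+sm) [L; b-3m]\<close> of Gaussian
  binomials; the two q-Pascal rules reduce them to one another with \<open>L\<close> lowered, because in each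
  reduction two of the four resulting sums cancel.

  Exchanging the sums leaves \<open>\<gamma>_r = \<Sum>n\<ge>r. q^n (q)_n / ((q)_{n-r} (q)_{n+r+1})\<close>. Up to the factor
  \<open>(q)_\<infinity>\<close> and a power of \<open>q\<close>, this is the tail \<open>j > r\<close> of the pentagonal number series
  \<open>\<Sum>j. (-1)^j q^(j(3j-1)/2) (1+q^j)\<close>, which produces the double sums.
\<close>

section \<open>Preliminaries\<close>

abbreviation qfact :: "complex \<Rightarrow> nat \<Rightarrow> complex" where
  "qfact q n \<equiv> qpoch q q n"

text \<open>The pentagonal numbers k(3k-1)/2. At k = 0 the truncated subtraction is harmless, since
  the factor k vanishes.\<close>

definition pent :: "nat \<Rightarrow> nat" where
  "pent k = (k * (3 * k - 1)) div 2"

lemma pent_0 [simp]: "pent 0 = 0"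
  by (simp add: pent_def)

lemma pent_Suc: "pent (Suc k) = pent k + 3 * k + 1"
proof -
  have "Suc k * (3 * Suc k - 1) = k * (3 * k - 1) + (3 * k + 1) * 2"
    by (cases k) (auto simp: algebra_simps)
  thus ?thesis by (simp add: pent_def)
qed

lemma pent_int: "int (pent k) = (int k * (3 * int k - 1)) div 2"
  by (cases k) (simp_all add: pent_def zdiv_int algebra_simps)

lemma pent_ge: "k \<le> pent k"
  by (induction k) (simp_all add: pent_Suc)

text \<open>With \<open>j = n + k\<close>, the term is \<open>(-1)^(j-n) q^(j(3j-1)/2 - n(3n-1)/2) (1+q^j)\<close>, written
  with natural exponents.\<close>

definition pent_tail_term :: "complex \<Rightarrow> nat \<Rightarrow> nat \<Rightarrow> complex" where
  "pent_tail_term q n k = (- 1) ^ k * q ^ (3 * n * k + pent k) * (1 + q ^ (n + k))"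

definition pent_tail :: "complex \<Rightarrow> nat \<Rightarrow> complex" where
  "pent_tail q n = (\<Sum>k. pent_tail_term q n k)"

lemma qfact_0 [simp]: "qfact q 0 = 1"
  by (simp add: qpoch_def)

lemma qfact_Suc: "qfact q (Suc n) = qfact q n * (1 - q ^ Suc n)"
  by (simp add: qpoch_def)

lemma qpoch_shift: "qfact q m * qpoch (q ^ Suc m) q n = qfact q (m + n)"
  by (induction n) (simp_all add: qpoch_def power_add algebra_simps)

section \<open>Absolutely convergent double series and their diagonals\<close>

text \<open>The majorant is a product of a family summable in i and a geometric series in k, so the
  norms are summable over all pairs.\<close>

lemma double_sum_summable:
  fixes f :: "'i \<Rightarrow> nat \<Rightarrow> complex" and \<rho> :: "'i \<Rightarrow> nat" and x K :: real
  assumes x: "0 \<le> x" "x < 1" and \<rho>: "(\<lambda>i. x ^ \<rho> i) summable_on UNIV"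
    and bound: "\<And>i k. norm (f i k) \<le> K * x ^ \<rho> i * x ^ k"
  shows "(\<lambda>(i, k). f i k) summable_on UNIV"
proof -
  have geo: "(\<lambda>k. x ^ k) summable_on (UNIV :: nat set)"
    using x by (intro norm_summable_imp_summable_on) (simp add: norm_power)
  have "(\<lambda>(i, k). x ^ \<rho> i * x ^ k) summable_on Sigma UNIV (\<lambda>_. UNIV :: nat set)"
  proof (rule summable_on_SigmaI)
    show "((\<lambda>k. case (i, k) of (i, k) \<Rightarrow> x ^ \<rho> i * x ^ k) has_sum x ^ \<rho> i * (\<Sum>\<^sub>\<infinity>k. x ^ k)) UNIV" for i
      using has_sum_cmult_right[OF has_sum_infsum[OF geo]] by simp
    show "(\<lambda>i. x ^ \<rho> i * (\<Sum>\<^sub>\<infinity>k. x ^ k)) summable_on UNIV"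
      using \<rho> by (rule summable_on_cmult_left)
  qed (use x in auto)
  hence "(\<lambda>p. K * (case p of (i, k) \<Rightarrow> x ^ \<rho> i * x ^ k)) summable_on UNIV"
    by (intro summable_on_cmult_right) simp
  hence "(\<lambda>p. norm (case p of (i, k) \<Rightarrow> f i k)) summable_on UNIV"
    by (rule Infinite_Sum.abs_summable_on_comparison_test') (use bound in \<open>auto simp: mult.assoc split: prod.splits\<close>)
  thus ?thesis by (rule Infinite_Sum.abs_summable_summable)
qed

text \<open>Pairs (i, k) are regrouped by n = \<open>\<rho> i + k\<close>. Each diagonal is a finite
  sum because only finitely many i satisfy \<open>\<rho> i \<le> n\<close>. The map
  \<open>\<rho>\<close> need not be injective.\<close>

lemma has_sum_diagonal:
  fixes f :: "'i \<Rightarrow> nat \<Rightarrow> complex" and \<rho> :: "'i \<Rightarrow> nat"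
  assumes f: "(\<lambda>(i, k). f i k) summable_on UNIV" and fin: "\<And>n. finite {i. \<rho> i \<le> n}"
  shows "((\<lambda>n. \<Sum>i | \<rho> i \<le> n. f i (n - \<rho> i)) has_sum (\<Sum>\<^sub>\<infinity>i. \<Sum>\<^sub>\<infinity>k. f i k)) UNIV"
proof -
  have "((\<lambda>(i, k). f i k) has_sum (\<Sum>\<^sub>\<infinity>i. \<Sum>\<^sub>\<infinity>k. f i k)) (Sigma UNIV (\<lambda>_. UNIV))"
    using infsum_Sigma_banach[of "\<lambda>(i, k). f i k" UNIV "\<lambda>_. UNIV"] has_sum_infsum[OF f] f by simp
  moreover have "bij_betw (\<lambda>(n, i). (i, n - \<rho> i)) (Sigma UNIV (\<lambda>n. {i. \<rho> i \<le> n})) (Sigma UNIV (\<lambda>_. UNIV))"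
    by (rule bij_betw_byWitness[where f' = "\<lambda>(i, k). (\<rho> i + k, i)"]) auto
  ultimately have "((\<lambda>p. case (case p of (n, i) \<Rightarrow> (i, n - \<rho> i)) of (i, k) \<Rightarrow> f i k)
      has_sum (\<Sum>\<^sub>\<infinity>i. \<Sum>\<^sub>\<infinity>k. f i k)) (Sigma UNIV (\<lambda>n. {i. \<rho> i \<le> n}))"
    by (simp only: has_sum_reindex_bij_betw)
  thus ?thesis
    by (rule has_sum_SigmaD) (use fin in \<open>simp add: has_sum_finite\<close>)
qed

text \<open>By symmetry, the Gaussian binomial \<open>[2n+1; n-i]\<close> is the same for \<open>i = 3m+d\<close> and
  \<open>i = -3m-d-1\<close>. The index in the Bailey pair is the nonnegative one of the two.\<close>

definition rho :: "int \<Rightarrow> int \<Rightarrow> nat" where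
  "rho d m = nat (if m \<ge> 0 then 3 * m + d else - 3 * m - 1 - d)"

text \<open>With j = n + 1 these are the ranges of the inner sums in the theorem: d = 0 gives those
  of the sums from j = 1, and d = 1 those of the sums from j = 2.\<close>

lemma rho_le_iff:
  "d \<in> {0, 1} \<Longrightarrow> rho d m \<le> n \<longleftrightarrow> - int (Suc n) - d \<le> 3 * m \<and> 3 * m \<le> int (Suc n) - 1 - d"
  by (auto simp: rho_def)

lemma finite_rho_le: "d \<in> {0, 1} \<Longrightarrow> finite {m. rho d m \<le> n}"
  by (rule finite_subset[of _ "{- int n - 2..int n}"]) (auto simp: rho_le_iff)

text \<open>\<open>rho 1\<close> is two-to-one, since \<open>rho 1 (- 1 - m) = rho 1 m\<close>, so the two signs of \<open>m\<close> are
  treated separately.\<close>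

lemma rho_summable:
  fixes x :: real
  assumes d: "d \<in> {0, 1}" and x: "0 \<le> x" "x < 1"
  shows "(\<lambda>m. x ^ rho d m) summable_on UNIV"
proof -
  have geo: "(\<lambda>k. x ^ k) summable_on (UNIV :: nat set)"
    using x by (intro norm_summable_imp_summable_on) (simp add: norm_power)
  have "(\<lambda>m. x ^ rho d m) summable_on A" if inj: "inj_on (rho d) A" for A
  proof -
    have "(\<lambda>k. x ^ k) summable_on rho d ` A"
      using geo by (rule summable_on_subset_banach) auto
    thus ?thesis
      using summable_on_reindex[OF inj, of "\<lambda>k. x ^ k"] by (simp add: o_def)
  qed
  moreover have "inj_on (rho d) {0..}" "inj_on (rho d) {..<0}"
    using d by (auto simp: inj_on_def rho_def)
  ultimately have "(\<lambda>m. x ^ rho d m) summable_on {0..} \<union> {..<0}"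
    by (intro summable_on_Un_disjoint) auto
  moreover have "{0..} \<union> {..<0} = (UNIV :: int set)" by auto
  ultimately show ?thesis by simp
qed

section \<open>Signs, summation from 1, and the integer exponents\<close>

lemma minus_one_powi: "(- 1 :: complex) powi n = (if even n then 1 else - 1)"
  by (simp add: power_int_minus_left)

lemma infsum_from_1:
  fixes g :: "int \<Rightarrow> complex"
  assumes "(f has_sum S) UNIV" and "\<And>n. f n = g (int (Suc n))"
  shows "(\<Sum>\<^sub>\<infinity>j\<in>{1..}. g j) = S"
proof -
  have bij: "bij_betw (\<lambda>n. int (Suc n)) UNIV {1..}"
    by (rule bij_betw_byWitness[where f' = "\<lambda>j. nat (j - 1)"]) auto
  have "f = (\<lambda>n. g (int (Suc n)))"
    using assms(2) by blast
  with assms(1) have "((\<lambda>n. g (int (Suc n))) has_sum S) UNIV"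
    by blast
  hence "(g has_sum S) {1..}"
    using has_sum_reindex_bij_betw[OF bij, of g S] by blast
  thus ?thesis by (rule infsumI)
qed

text \<open>Both products are even, the second because k is odd. Exponents are compared after
  doubling, where no division is left.\<close>

lemma twice_exponent:
  fixes j m k c :: int
  assumes "odd k"
  shows "2 * (j * (3 * j - 1) div 2 - m * (21 * m + k) div 2 - c)
    = j * (3 * j - 1) - m * (21 * m + k) - 2 * c"
proof -
  have "even (j * (3 * j - 1))" "even (m * (21 * m + k))" using assms by simp_all
  thus ?thesis by simp
qed

text \<open>The first five quadratics split into linear factors whose two roots have no integer
  strictly between them, so the factors never have opposite signs at an integer. Nonnegativity
  bounds the corresponding powers of q by 1 in norm.\<close>

lemma quadratic_nonneg:
  fixes m :: int
  shows "0 \<le> 3 * m\<^sup>2 - m" "0 \<le> 3 * m\<^sup>2 - 2 * m" "0 \<le> 3 * m\<^sup>2 + 2 * m"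
    "0 \<le> 3 * m\<^sup>2 + 4 * m + 1" "0 \<le> 3 * m\<^sup>2 + 5 * m + 2"
    "0 \<le> 3 * m\<^sup>2 + 2 * m + 1" "0 \<le> 3 * m\<^sup>2 + 4 * m + 2"
proof -
  have "3 * m\<^sup>2 - m = m * (3 * m - 1)" "3 * m\<^sup>2 - 2 * m = m * (3 * m - 2)"
    "3 * m\<^sup>2 + 2 * m = m * (3 * m + 2)" "3 * m\<^sup>2 + 4 * m + 1 = (3 * m + 1) * (m + 1)"
    "3 * m\<^sup>2 + 5 * m + 2 = (3 * m + 2) * (m + 1)"
    by (simp_all add: power2_eq_square algebra_simps)
  thus *: "0 \<le> 3 * m\<^sup>2 - m" "0 \<le> 3 * m\<^sup>2 - 2 * m" "0 \<le> 3 * m\<^sup>2 + 2 * m"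
    "0 \<le> 3 * m\<^sup>2 + 4 * m + 1" "0 \<le> 3 * m\<^sup>2 + 5 * m + 2"
    by (auto simp only: zero_le_mult_iff)
  show "0 \<le> 3 * m\<^sup>2 + 2 * m + 1" "0 \<le> 3 * m\<^sup>2 + 4 * m + 2"
    using *(3,4) by simp_all
qed

section \<open>A conjugate Bailey pair\<close>

context
  fixes q :: complex
  assumes q: "norm q < 1"
begin

section \<open>Convergence and boundedness of the q-factorials\<close>

lemma norm_q_power_le: "norm (q ^ n) \<le> 1"
  using q by (simp add: norm_power power_le_one)

lemma q_power_ne_1: "n > 0 \<Longrightarrow> q ^ n \<noteq> 1"
  using q power_Suc_less_one[of "norm q" "n - 1"]
  by (metis Suc_pred' norm_ge_zero norm_one norm_power order_less_irrefl power_0_left power_less_one_iff zero_less_one power_less_one_iff)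

lemma qfact_nonzero [simp]: "qfact q n \<noteq> 0"
proof (induction n)
  case (Suc n)
  thus ?case using q_power_ne_1[of "Suc n"] by (simp add: qfact_Suc del: power_Suc)
qed simp

lemma q_power_tendsto_0: "(\<lambda>n. q ^ n) \<longlonglongrightarrow> 0"
  using q by (rule LIMSEQ_power_zero)

lemma conv_prod: "convergent_prod (\<lambda>n. 1 - q ^ Suc n)"
proof (rule abs_convergent_prod_imp_convergent_prod)
  have "summable (\<lambda>i. norm q ^ Suc i)"
    using q by (subst summable_Suc_iff) (simp add: summable_geometric)
  thus "abs_convergent_prod (\<lambda>n. 1 - q ^ Suc n)"
    by (simp add: abs_convergent_prod_conv_summable norm_mult norm_power)
qed

lemma qpoch_inf_nonzero [simp]: "qpoch_inf q \<noteq> 0"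
  unfolding qpoch_inf_def using q_power_ne_1 by (intro prodinf_nonzero conv_prod) (metis eq_iff_diff_eq_0 zero_less_Suc)

lemma qfact_tendsto: "qfact q \<longlonglongrightarrow> qpoch_inf q"
proof -
  have "(\<lambda>n. \<Prod>i\<le>n. 1 - q ^ Suc i) \<longlonglongrightarrow> qpoch_inf q"
    unfolding qpoch_inf_def by (intro convergent_prod_LIMSEQ conv_prod)
  hence "(\<lambda>n. \<Prod>i<n. 1 - q ^ Suc i) \<longlonglongrightarrow> qpoch_inf q"
    by (simp only: LIMSEQ_lessThan_iff_atMost)
  thus ?thesis by (simp add: qpoch_def)
qed

lemma qfact_bounded: "\<exists>C>0. \<forall>n. norm (qfact q n) \<le> C"
  using convergent_imp_Bseq[OF convergentI[OF qfact_tendsto]] by (auto simp: Bseq_def)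

lemma inverse_qfact_bounded: "\<exists>C>0. \<forall>n. norm (1 / qfact q n) \<le> C"
proof -
  have "(\<lambda>n. 1 / qfact q n) \<longlonglongrightarrow> 1 / qpoch_inf q"
    by (intro tendsto_intros qfact_tendsto) simp
  from convergent_imp_Bseq[OF convergentI[OF this]] show ?thesis by (auto simp: Bseq_def)
qed

section \<open>The series \<open>\<gamma>_r\<close> as a pentagonal tail\<close>

text \<open>The summand of \<open>\<gamma>_r\<close> for r = \<open>n\<close> and summation index r
  + \<open>s\<close>, with the factor q^r taken out.\<close>

definition gamma_term :: "nat \<Rightarrow> nat \<Rightarrow> complex" where
  "gamma_term n s = q ^ s * qfact q (n + s) / (qfact q s * qfact q (2 * n + s + 1))"

text \<open>The constant is uniform in n. This is needed for the majorant of the double series and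
  for comparing the two solutions of the recurrence.\<close>

lemma gamma_term_bound: "\<exists>C>0. \<forall>n s. norm (gamma_term n s) \<le> C * norm q ^ s"
proof -
  obtain C D where C: "C > 0" "\<And>n. norm (qfact q n) \<le> C"
    and D: "D > 0" "\<And>n. norm (1 / qfact q n) \<le> D"
    using qfact_bounded inverse_qfact_bounded by metis
  have "norm (gamma_term n s) \<le> C * D * D * norm q ^ s" for n s
  proof -
    have "norm (gamma_term n s) = norm (qfact q (n + s)) * norm (1 / qfact q s)
        * norm (1 / qfact q (2 * n + s + 1)) * norm q ^ s"
      by (simp add: gamma_term_def norm_mult norm_divide norm_power)
    also have "\<dots> \<le> C * D * D * norm q ^ s"
      using C D by (intro mult_right_mono mult_mono C(2) D(2)) simp_all
    finally show ?thesis .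
  qed
  thus ?thesis using C D by (intro exI[of _ "C * D * D"]) simp
qed

lemma gamma_term_summable: "summable (\<lambda>s. norm (gamma_term n s))"
proof -
  obtain C where "\<And>s. norm (gamma_term n s) \<le> C * norm q ^ s"
    using gamma_term_bound by blast
  moreover have "summable (\<lambda>s. C * norm q ^ s)"
    using q by (intro summable_mult summable_geometric) simp
  ultimately show ?thesis
    using summable_comparison_test'[of "\<lambda>s. C * norm q ^ s" 0 "\<lambda>s. norm (gamma_term n s)"] by simp
qed

lemma pent_tail_term_bound: "norm (pent_tail_term q n k) \<le> 2 * norm q ^ k"
proof -
  have "norm (1 + q ^ (n + k)) \<le> 1 + 1"
    using norm_triangle_ineq[of 1 "q ^ (n + k)"] norm_q_power_le[of "n + k"] by simp
  moreover have "norm q ^ (3 * n * k + pent k) \<le> norm q ^ k"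
    using q pent_ge[of k] by (intro power_decreasing) auto
  ultimately have "norm q ^ (3 * n * k + pent k) * norm (1 + q ^ (n + k)) \<le> norm q ^ k * 2"
    by (intro mult_mono) auto
  thus ?thesis by (simp add: pent_tail_term_def norm_mult norm_power)
qed

lemma pent_tail_term_summable: "summable (\<lambda>k. norm (pent_tail_term q n k))"
proof (rule summable_comparison_test')
  show "summable (\<lambda>k. 2 * norm q ^ k)"
    using q by (intro summable_mult summable_geometric) simp
  show "norm (norm (pent_tail_term q n k)) \<le> 2 * norm q ^ k" if "k \<ge> 0" for k
    using pent_tail_term_bound by simp
qed

text \<open>The term k = 0 is 1 + q^n. Replacing k by k + 1 in the others gives the terms of the
  next tail, because 3n(k+1) + \<open>pent (k+1)\<close> = (3n+1) + 3(n+1)k +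
  \<open>pent k\<close>.\<close>

lemma pent_tail_rec: "pent_tail q n = 1 + q ^ n - q ^ (3 * n + 1) * pent_tail q (Suc n)"
proof -
  have "pent_tail_term q n (Suc k) = - (q ^ (3 * n + 1)) * pent_tail_term q (Suc n) k" for k
  proof -
    have "3 * n * Suc k + pent (Suc k) = (3 * n + 1) + (3 * Suc n * k + pent k)"
      by (simp add: pent_Suc algebra_simps)
    hence "q ^ (3 * n * Suc k + pent (Suc k)) = q ^ (3 * n + 1) * q ^ (3 * Suc n * k + pent k)"
      by (simp only: power_add)
    thus ?thesis unfolding pent_tail_term_def by simp
  qed
  hence "(\<Sum>k. pent_tail_term q n (Suc k)) = - (q ^ (3 * n + 1)) * pent_tail q (Suc n)"
    unfolding pent_tail_def
    by (simp only: suminf_mult[OF summable_norm_cancel[OF pent_tail_term_summable]])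
  moreover have "(\<Sum>k. pent_tail_term q n (Suc k)) = pent_tail q n - pent_tail_term q n 0"
    unfolding pent_tail_def
    by (rule suminf_split_head[OF summable_norm_cancel[OF pent_tail_term_summable]])
  ultimately show ?thesis by (simp add: pent_tail_term_def algebra_simps)
qed

text \<open>The certificate \<open>R\<close> was found by the q-Zeilberger method.\<close>

lemma gamma_rec:
  "suminf (gamma_term n) + q ^ (3 * n + 4) * suminf (gamma_term (Suc n)) = (1 + q ^ Suc n) / qpoch_inf q"
proof -
  define y where "y = q ^ Suc n"
  define R where "R = (\<lambda>s. qfact q (n + s) / (qfact q s * qfact q (2 * n + s + 2)) * (1 - q ^ s) * (1 + y - y\<^sup>2 * q ^ s))"
  have step: "gamma_term n s + q ^ (3 * n + 4) * gamma_term (Suc n) s = R (Suc s) - R s" for s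
  proof -
    \<comment> \<open>In terms of \<open>x\<close>, \<open>y\<close> and q, every q-factorial
      involved is \<open>A\<close>, \<open>B\<close> or \<open>D\<close> times a polynomial.
      Extracting the common factor \<open>W\<close> below turns the telescoping relation into a
      polynomial identity.\<close>
    define x where "x = q ^ s"
    define A where "A = qfact q (n + s)"
    define B where "B = qfact q s"
    define D where "D = qfact q (2 * n + s + 1)"
    have q2n: "q ^ (2 * n) = q ^ n * q ^ n" "q ^ (n * 2) = q ^ n * q ^ n"
      by (simp_all add: mult_2 mult_2_right power_add)
    have xq: "q ^ Suc s = x * q" "q ^ (2 * n + s + 2) = y\<^sup>2 * x" "q ^ (2 * n + s + 3) = y\<^sup>2 * x * q"
      by (simp_all add: x_def y_def power_add q2n power2_eq_square power3_eq_cube mult_ac)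
    have nz: "1 - x * q \<noteq> 0" "1 - y\<^sup>2 * x \<noteq> 0" "1 - y\<^sup>2 * x * q \<noteq> 0" "B \<noteq> 0" "D \<noteq> 0"
      using q_power_ne_1[of "Suc s"] q_power_ne_1[of "2 * n + s + 2"] q_power_ne_1[of "2 * n + s + 3"]
      unfolding xq by (simp_all add: B_def D_def)
    have e1: "qfact q (n + Suc s) = A * (1 - y * x)" "qfact q (Suc s) = B * (1 - x * q)" "q ^ Suc s = q * x"
      using qfact_Suc[of q "n + s"] qfact_Suc[of q s]
      by (simp_all add: x_def y_def A_def B_def power_add algebra_simps)
    have e2: "qfact q (2 * n + s + 2) = D * (1 - y\<^sup>2 * x)"
      using qfact_Suc[of q "2 * n + s + 1"]
      by (simp add: x_def y_def D_def power_add q2n power2_eq_square algebra_simps)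
    have "qfact q (2 * n + Suc s + 2) = qfact q (2 * n + s + 2) * (1 - y\<^sup>2 * x * q)"
      using qfact_Suc[of q "2 * n + s + 2"]
      by (simp add: x_def y_def power_add q2n power2_eq_square algebra_simps)
    hence e3: "qfact q (2 * n + Suc s + 2) = D * (1 - y\<^sup>2 * x) * (1 - y\<^sup>2 * x * q)"
      by (simp only: e2)
    have "Suc n + s = n + Suc s" "2 * Suc n + s + 1 = 2 * n + Suc s + 2" by simp_all
    hence e: "qfact q (Suc n + s) = A * (1 - y * x)"
      "qfact q (2 * Suc n + s + 1) = D * (1 - y\<^sup>2 * x) * (1 - y\<^sup>2 * x * q)"
      using e1(1) e3 by simp_all
    have "3 * n + 4 = 3 * Suc n + 1" by simp
    hence y3: "q ^ (3 * n + 4) = y ^ 3 * q"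
      unfolding y_def by (simp only: power_add power_mult power_one_right mult.commute[of 3])
    define u v where "u = 1 - y\<^sup>2 * x" and "v = 1 - y\<^sup>2 * x * q"
    define W where "W = A / (B * D * u * v)"
    have nz': "u \<noteq> 0" "v \<noteq> 0" "1 - x * q \<noteq> 0" "B \<noteq> 0" "D \<noteq> 0"
      using nz by (simp_all add: u_def v_def)
    note e = e e1 e2 e3
    have L1: "gamma_term n s = W * (x * u * v)"
      using nz' by (simp add: gamma_term_def W_def A_def B_def D_def x_def)
    have L2: "gamma_term (Suc n) s = W * (x * (1 - y * x))"
      using nz' unfolding gamma_term_def e W_def u_def[symmetric] v_def[symmetric]
        B_def[symmetric] x_def[symmetric] by (simp add: mult_ac)
    have R1: "R s = W * ((1 - x) * v * (1 + y - y\<^sup>2 * x))"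
      using nz' unfolding R_def e W_def u_def[symmetric] v_def[symmetric]
        A_def[symmetric] B_def[symmetric] x_def[symmetric] by simp
    have R2: "R (Suc s) = W * ((1 - y * x) * (1 + y - y\<^sup>2 * (q * x)))"
      using nz' unfolding R_def e W_def u_def[symmetric] v_def[symmetric] by (simp add: mult_ac)
    have "x * u * v + y ^ 3 * q * (x * (1 - y * x)) =
        (1 - y * x) * (1 + y - y\<^sup>2 * (q * x)) - (1 - x) * v * (1 + y - y\<^sup>2 * x)"
      unfolding u_def v_def by algebra
    from arg_cong[OF this, of "(*) W"]
    have "W * (x * u * v) + y ^ 3 * q * (W * (x * (1 - y * x))) =
        W * ((1 - y * x) * (1 + y - y\<^sup>2 * (q * x))) - W * ((1 - x) * v * (1 + y - y\<^sup>2 * x))"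
      by (simp only: distrib_left right_diff_distrib[of W] mult.left_commute[of W])
    thus ?thesis unfolding L1 L2 R1 R2 y3 .
  qed
  have lim: "(\<lambda>s. qfact q (n + s)) \<longlonglongrightarrow> qpoch_inf q"
    "(\<lambda>s. qfact q (2 * n + s + 2)) \<longlonglongrightarrow> qpoch_inf q"
    using LIMSEQ_ignore_initial_segment[OF qfact_tendsto, of n]
      LIMSEQ_ignore_initial_segment[OF qfact_tendsto, of "2 * n + 2"]
    by (simp_all add: add_ac)
  have "R \<longlonglongrightarrow> qpoch_inf q / (qpoch_inf q * qpoch_inf q) * (1 - 0) * (1 + y - y\<^sup>2 * 0)"
    unfolding R_def
    by (intro tendsto_mult tendsto_divide tendsto_diff tendsto_add tendsto_const q_power_tendsto_0
        qfact_tendsto lim) simp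
  hence "R \<longlonglongrightarrow> (1 + y) / qpoch_inf q" by simp
  \<comment> \<open>The factor 1 - q^s makes \<open>R 0\<close> vanish, so the sum is the limit of
    \<open>R\<close>.\<close>
  from telescope_sums[OF this] have "(\<lambda>s. gamma_term n s + q ^ (3 * n + 4) * gamma_term (Suc n) s) sums ((1 + y) / qpoch_inf q)"
    by (simp add: step R_def)
  moreover have "(\<lambda>s. gamma_term n s + q ^ (3 * n + 4) * gamma_term (Suc n) s) sums
      (suminf (gamma_term n) + q ^ (3 * n + 4) * suminf (gamma_term (Suc n)))"
    by (intro sums_add sums_mult summable_sums summable_norm_cancel[OF gamma_term_summable])
  ultimately show ?thesis unfolding y_def by (rule sums_unique2[symmetric])
qed

text \<open>Both sides satisfy the same recurrence in \<open>n\<close> and are bounded, and iterating the recurrence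
  multiplies the difference by arbitrarily high powers of \<open>q\<close>.\<close>

lemma gamma_eq: "suminf (gamma_term n) = pent_tail q (Suc n) / qpoch_inf q"
proof -
  define D where "D = (\<lambda>n. qpoch_inf q * suminf (gamma_term n) - pent_tail q (Suc n))"
  have rec: "D n = - (q ^ (3 * n + 4)) * D (Suc n)" for n
  proof -
    have "3 * Suc n + 1 = 3 * n + 4" by simp
    with gamma_rec[of n] pent_tail_rec[of "Suc n"] show ?thesis
      unfolding D_def by (simp add: field_simps)
  qed
  have geo: "(\<lambda>k. norm q ^ k) sums (1 / (1 - norm q))"
    using q geometric_sums[of "norm q"] by simp
  obtain C where C: "\<And>n s. norm (gamma_term n s) \<le> C * norm q ^ s"
    using gamma_term_bound by blast
  define M where "M = norm (qpoch_inf q) * (C / (1 - norm q)) + 2 / (1 - norm q)"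
  have bound: "norm (D n) \<le> M" for n
  proof -
    have "norm (suminf (gamma_term n)) \<le> (\<Sum>k. C * norm q ^ k)"
      using C geo by (intro norm_suminf_le) (auto simp: sums_iff intro!: summable_mult)
    moreover have "norm (pent_tail q (Suc n)) \<le> (\<Sum>k. 2 * norm q ^ k)"
      unfolding pent_tail_def using pent_tail_term_bound geo
      by (intro norm_suminf_le) (auto simp: sums_iff intro!: summable_mult)
    ultimately have *: "norm (suminf (gamma_term n)) \<le> C / (1 - norm q)" "norm (pent_tail q (Suc n)) \<le> 2 / (1 - norm q)"
      using sums_mult[OF geo, of C] sums_mult[OF geo, of 2] by (auto simp: sums_iff)
    have "norm (D n) \<le> norm (qpoch_inf q) * norm (suminf (gamma_term n)) + norm (pent_tail q (Suc n))"
      unfolding D_def by (metis norm_mult norm_triangle_ineq4)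
    also have "\<dots> \<le> M"
      unfolding M_def using * by (intro add_mono mult_left_mono) auto
    finally show ?thesis .
  qed
  have iter: "norm (D n) \<le> norm q ^ k * M" for n k
  proof (induction k arbitrary: n)
    case 0
    thus ?case using bound by simp
  next
    case (Suc k)
    have "norm (D n) = norm q ^ (3 * n + 4) * norm (D (Suc n))"
      using rec[of n] by (simp add: norm_mult norm_power)
    \<comment> \<open>A single factor q out of q^(3n+4) suffices at each iteration.\<close>
    also have "\<dots> \<le> norm q ^ 1 * (norm q ^ k * M)"
      using q Suc.IH[of "Suc n"] by (intro mult_mono power_decreasing) auto
    finally show ?case by (simp add: mult.assoc)
  qed
  have "(\<lambda>k. norm q ^ k * M) \<longlonglongrightarrow> 0 * M"
    using q by (intro tendsto_mult LIMSEQ_power_zero) auto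
  hence "norm (D n) \<le> 0 * M"
    by (rule LIMSEQ_le_const) (use iter in auto)
  thus ?thesis by (simp add: D_def field_simps)
qed

section \<open>Exchange of summation\<close>

text \<open>Bailey's transform with weights q^n (q)_n. The double series \<open>f\<close> with the
  terms of \<open>\<gamma>\<close> has the sums of \<open>q ^ n * qfact q n * \<beta> n\<close> as
  diagonals. The double series \<open>g\<close> with the terms of the pentagonal tails has
  \<open>\<sigma>\<close> as diagonals. Their row sums agree up to the factor
  \<open>qpoch_inf q\<close>.\<close>

lemma bailey_sum:
  fixes a :: "'i \<Rightarrow> complex" and \<rho> :: "'i \<Rightarrow> nat"
  assumes \<rho>: "(\<lambda>i. norm q ^ \<rho> i) summable_on UNIV" and fin: "\<And>n. finite {i. \<rho> i \<le> n}"
    and a: "\<And>i. norm (a i) \<le> C"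
  defines "\<beta> \<equiv> \<lambda>n. \<Sum>i | \<rho> i \<le> n. a i / (qfact q (n - \<rho> i) * qfact q (n + \<rho> i + 1))"
  defines "\<sigma> \<equiv> \<lambda>n. \<Sum>i | \<rho> i \<le> n. a i * q ^ \<rho> i * pent_tail_term q (Suc (\<rho> i)) (n - \<rho> i)"
  shows "(\<lambda>n. q ^ n * qfact q n * \<beta> n) summable_on UNIV"
    and "(\<sigma> has_sum qpoch_inf q * (\<Sum>\<^sub>\<infinity>n. q ^ n * qfact q n * \<beta> n)) UNIV"
proof -
  have C: "C \<ge> 0"
    \<comment> \<open>Any index serves: a bound on a norm is nonnegative.\<close>
    using a[of undefined] by (meson norm_ge_zero order_trans)
  obtain D where D: "D > 0" "\<And>n s. norm (gamma_term n s) \<le> D * norm q ^ s"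
    using gamma_term_bound by blast
  define f where "f = (\<lambda>i s. a i * q ^ \<rho> i * gamma_term (\<rho> i) s)"
  define g where "g = (\<lambda>i k. a i * q ^ \<rho> i * pent_tail_term q (Suc (\<rho> i)) k)"
  have f: "(\<lambda>(i, k). f i k) summable_on UNIV"
  proof (intro double_sum_summable[OF _ q \<rho>])
    fix i k
    have "norm (f i k) = norm (a i) * norm q ^ \<rho> i * norm (gamma_term (\<rho> i) k)"
      by (simp add: f_def norm_mult norm_power)
    also have "\<dots> \<le> C * norm q ^ \<rho> i * (D * norm q ^ k)"
      using C D a by (intro mult_mono) auto
    finally show "norm (f i k) \<le> (C * D) * norm q ^ \<rho> i * norm q ^ k" by (simp add: algebra_simps)
  qed auto
  have g: "(\<lambda>(i, k). g i k) summable_on UNIV"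
  proof (intro double_sum_summable[OF _ q \<rho>])
    fix i k
    have "norm (g i k) = norm (a i) * norm q ^ \<rho> i * norm (pent_tail_term q (Suc (\<rho> i)) k)"
      by (simp add: g_def norm_mult norm_power)
    also have "\<dots> \<le> C * norm q ^ \<rho> i * (2 * norm q ^ k)"
      using C pent_tail_term_bound a by (intro mult_mono) auto
    finally show "norm (g i k) \<le> (C * 2) * norm q ^ \<rho> i * norm q ^ k" by (simp add: algebra_simps)
  qed auto
  have "q ^ n * qfact q n * \<beta> n = (\<Sum>i | \<rho> i \<le> n. f i (n - \<rho> i))" for n
    unfolding \<beta>_def sum_distrib_left f_def gamma_term_def
  proof (intro sum.cong refl)
    fix i assume "i \<in> {i. \<rho> i \<le> n}"
    hence "q ^ n = q ^ \<rho> i * q ^ (n - \<rho> i)" "\<rho> i + (n - \<rho> i) = n"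
      "2 * \<rho> i + (n - \<rho> i) + 1 = n + \<rho> i + 1"
      by (auto simp flip: power_add)
    thus "q ^ n * qfact q n * (a i / (qfact q (n - \<rho> i) * qfact q (n + \<rho> i + 1))) =
        a i * q ^ \<rho> i * (q ^ (n - \<rho> i) * qfact q (\<rho> i + (n - \<rho> i)) /
        (qfact q (n - \<rho> i) * qfact q (2 * \<rho> i + (n - \<rho> i) + 1)))"
      by (simp add: mult_ac add_ac)
  qed
  with has_sum_diagonal[OF f fin]
  have \<beta>: "((\<lambda>n. q ^ n * qfact q n * \<beta> n) has_sum (\<Sum>\<^sub>\<infinity>i. \<Sum>\<^sub>\<infinity>k. f i k)) UNIV"
    by simp
  thus "(\<lambda>n. q ^ n * qfact q n * \<beta> n) summable_on UNIV"
    by (rule has_sum_imp_summable)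
  have "(\<Sum>\<^sub>\<infinity>k. g i k) = qpoch_inf q * (\<Sum>\<^sub>\<infinity>k. f i k)" for i
  proof -
    have "(gamma_term (\<rho> i) has_sum (pent_tail q (Suc (\<rho> i)) / qpoch_inf q)) UNIV"
      using norm_summable_imp_has_sum[OF gamma_term_summable] gamma_eq
      by (metis gamma_term_summable summable_norm_cancel summable_sums)
    hence 1: "(f i has_sum (a i * q ^ \<rho> i * (pent_tail q (Suc (\<rho> i)) / qpoch_inf q))) UNIV"
      unfolding f_def by (rule has_sum_cmult_right)
    have "(pent_tail_term q (Suc (\<rho> i)) has_sum pent_tail q (Suc (\<rho> i))) UNIV"
      unfolding pent_tail_def
      by (intro norm_summable_imp_has_sum pent_tail_term_summable summable_sums summable_norm_cancel)
    hence 2: "(g i has_sum (a i * q ^ \<rho> i * pent_tail q (Suc (\<rho> i)))) UNIV"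
      unfolding g_def by (rule has_sum_cmult_right)
    show ?thesis using infsumI[OF 1] infsumI[OF 2] by simp
  qed
  hence "(\<Sum>\<^sub>\<infinity>i. \<Sum>\<^sub>\<infinity>k. g i k) = qpoch_inf q * (\<Sum>\<^sub>\<infinity>i. \<Sum>\<^sub>\<infinity>k. f i k)"
    by (simp add: infsum_cmult_right')
  with has_sum_diagonal[OF g fin] infsumI[OF \<beta>]
  show "(\<sigma> has_sum qpoch_inf q * (\<Sum>\<^sub>\<infinity>n. q ^ n * qfact q n * \<beta> n)) UNIV"
    unfolding \<sigma>_def g_def by simp
qed

section \<open>Finite Bailey pair identities\<close>

context
  assumes q0: "q \<noteq> 0"
begin

section \<open>Gaussian binomials\<close>

text \<open>The lower index is an integer and the value outside 0..L is 0, so sums can run over all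
  integers and be shifted without boundary terms.\<close>

definition qbin :: "nat \<Rightarrow> int \<Rightarrow> complex" where
  "qbin L a = (if 0 \<le> a \<and> a \<le> int L then qfact q L / (qfact q (nat a) * qfact q (nat (int L - a))) else 0)"

text \<open>The exponents may be negative here, and the addition law fails at q = 0; for instance 1
  + (-1) would give 1 = 0. This is why q = 0 is treated separately.\<close>

lemma q_powi_add: "q powi (m + n) = q powi m * q powi n"
  using q0 by (simp add: power_int_add)

lemma qbin_sym: "qbin L (int L - a) = qbin L a"
  by (simp add: qbin_def mult.commute)

text \<open>For 1 \<le> a \<le> L the rule reduces to 1 - xy = (1 - x) + x(1 - y) with x = q^a and y
  = q^(L+1-a). At and beyond the ends it follows from the vanishing convention.\<close>

lemma qbin_pascal: "qbin (Suc L) a = qbin L (a - 1) + q powi a * qbin L a"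
proof -
  consider "a < 0 \<or> a > int (Suc L)" | "a = 0" | "a = int (Suc L)" | "1 \<le> a" "a \<le> int L"
    by linarith
  thus ?thesis
  proof cases
    case 4
    define b c where "b = nat (a - 1)" and "c = nat (int L - a)"
    have a: "a = int (Suc b)" and L: "L = Suc (b + c)"
      using 4 by (auto simp: b_def c_def)
    define x y where "x = q ^ Suc b" and "y = q ^ Suc c"
    have nz: "1 - x \<noteq> 0" "1 - y \<noteq> 0"
      using q_power_ne_1[of "Suc b"] q_power_ne_1[of "Suc c"] by (simp_all add: x_def y_def)
    have "Suc L = Suc b + Suc c" by (simp add: L)
    hence "q ^ Suc L = x * y"
      unfolding x_def y_def by (simp only: power_add)
    hence "qfact q (Suc L) = qfact q L * (1 - x * y)" "q powi a = x"
      by (simp_all only: qfact_Suc x_def a power_int_of_nat)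
    moreover have "qfact q (Suc b) = qfact q b * (1 - x)" "qfact q (Suc c) = qfact q c * (1 - y)"
      unfolding x_def y_def by (rule qfact_Suc)+
    moreover have "qbin (Suc L) a = qfact q (Suc L) / (qfact q (Suc b) * qfact q (Suc c))"
      "qbin L (a - 1) = qfact q L / (qfact q b * qfact q (Suc c))"
      "qbin L a = qfact q L / (qfact q (Suc b) * qfact q c)"
    proof -
      have "nat (int (Suc L) - a) = Suc c" "nat (int L - a) = c" "nat (a - 1) = b"
        "nat (int L - (a - 1)) = Suc c" "nat a = Suc b"
        by (simp_all add: a L)
      thus "qbin (Suc L) a = qfact q (Suc L) / (qfact q (Suc b) * qfact q (Suc c))"
        "qbin L (a - 1) = qfact q L / (qfact q b * qfact q (Suc c))"
        "qbin L a = qfact q L / (qfact q (Suc b) * qfact q c)"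
        using 4 by (simp_all add: qbin_def)
    qed
    ultimately have *: "qbin (Suc L) a = qfact q L * (1 - x * y) / (qfact q b * (1 - x) * (qfact q c * (1 - y)))"
      "qbin L (a - 1) = qfact q L / (qfact q b * (qfact q c * (1 - y)))"
      "q powi a * qbin L a = x * (qfact q L / (qfact q b * (1 - x) * qfact q c))"
      by simp_all
    show ?thesis
      unfolding * using nz qfact_nonzero[of b] qfact_nonzero[of c]
      by (simp add: divide_simps) (simp add: algebra_simps)
  qed (use qfact_nonzero in \<open>auto simp: qbin_def nat_add_distrib\<close>)
qed

section \<open>Finite theta sums weighted by Gaussian binomials\<close>

definition qbin_theta :: "int \<Rightarrow> nat \<Rightarrow> int \<Rightarrow> complex" where
  "qbin_theta s L b = (\<Sum>\<^sub>\<infinity>m. q powi (3 * m\<^sup>2 + s * m) * qbin L (b - 3 * m))"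

lemma qbin_finite_support: "finite {m. c m * qbin L (b - 3 * m) \<noteq> 0}"
proof -
  have "inj (\<lambda>m. b - 3 * m)" by (rule injI) simp
  hence "finite ((\<lambda>m. b - 3 * m) -` {0..int L})" by (intro finite_vimageI) auto
  thus ?thesis by (rule rev_finite_subset) (auto simp: qbin_def split: if_splits)
qed

lemma qbin_summable: "(\<lambda>m. c m * qbin L (b - 3 * m)) summable_on UNIV"
  using qbin_finite_support[of c L b] by (intro finite_nonzero_values_imp_summable_on) simp

text \<open>Substitution of m + 1 for m.\<close>

lemma qbin_theta_shift: "qbin_theta s L b = q powi (3 + s) * qbin_theta (s + 6) L (b - 3)"
proof -
  have "bij_betw (\<lambda>m. m + 1) UNIV (UNIV :: int set)"
    by (rule bij_betw_byWitness[where f' = "\<lambda>m. m - 1"]) auto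
  from infsum_reindex_bij_betw[OF this, of "\<lambda>m. q powi (3 * m\<^sup>2 + s * m) * qbin L (b - 3 * m)"]
  have "qbin_theta s L b = (\<Sum>\<^sub>\<infinity>m. q powi (3 * (m + 1)\<^sup>2 + s * (m + 1)) * qbin L (b - 3 * (m + 1)))"
    by (simp add: qbin_theta_def)
  also have "\<dots> = (\<Sum>\<^sub>\<infinity>m. q powi (3 + s) * (q powi (3 * m\<^sup>2 + (s + 6) * m) * qbin L (b - 3 - 3 * m)))"
  proof (rule infsum_cong)
    fix m :: int
    have "3 * (m + 1)\<^sup>2 + s * (m + 1) = (3 + s) + (3 * m\<^sup>2 + (s + 6) * m)" "b - 3 * (m + 1) = b - 3 - 3 * m"
      by (simp_all add: power2_eq_square algebra_simps)
    thus "q powi (3 * (m + 1)\<^sup>2 + s * (m + 1)) * qbin L (b - 3 * (m + 1))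
        = q powi (3 + s) * (q powi (3 * m\<^sup>2 + (s + 6) * m) * qbin L (b - 3 - 3 * m))"
      by (simp only: q_powi_add mult.assoc)
  qed
  also have "\<dots> = q powi (3 + s) * qbin_theta (s + 6) L (b - 3)"
    unfolding qbin_theta_def by (rule infsum_cmult_right')
  finally show ?thesis .
qed

text \<open>Substitution of - m for m, followed by the symmetry of the Gaussian binomial.\<close>

lemma qbin_theta_neg: "qbin_theta s L b = qbin_theta (- s) L (int L - b)"
proof -
  have "bij_betw uminus UNIV (UNIV :: int set)"
    by (rule bij_betw_byWitness[where f' = uminus]) auto
  from infsum_reindex_bij_betw[OF this, of "\<lambda>m. q powi (3 * m\<^sup>2 + s * m) * qbin L (b - 3 * m)"]
  have "qbin_theta s L b = (\<Sum>\<^sub>\<infinity>m. q powi (3 * m\<^sup>2 - s * m) * qbin L (b + 3 * m))"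
    by (simp add: qbin_theta_def)
  moreover have "qbin L (b + 3 * m) = qbin L (int L - b - 3 * m)" for m
    using qbin_sym[of L "b + 3 * m"] by (simp add: algebra_simps)
  ultimately show ?thesis by (simp add: qbin_theta_def)
qed

text \<open>The power q^(b-3m) from the Pascal rule contributes q^b and lowers the linear
  coefficient s by 3.\<close>

lemma qbin_theta_pascal: "qbin_theta s (Suc L) b = qbin_theta s L (b - 1) + q powi b * qbin_theta (s - 3) L b"
proof -
  have "qbin_theta s (Suc L) b = (\<Sum>\<^sub>\<infinity>m. q powi (3 * m\<^sup>2 + s * m) * qbin L ((b - 1) - 3 * m)
      + q powi b * (q powi (3 * m\<^sup>2 + (s - 3) * m) * qbin L (b - 3 * m)))"
    unfolding qbin_theta_def
  proof (rule infsum_cong)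
    fix m :: int
    have "(3 * m\<^sup>2 + s * m) + (b - 3 * m) = b + (3 * m\<^sup>2 + (s - 3) * m)"
      by (simp add: algebra_simps)
    hence "q powi (3 * m\<^sup>2 + s * m) * q powi (b - 3 * m) = q powi b * q powi (3 * m\<^sup>2 + (s - 3) * m)"
      by (metis q_powi_add)
    moreover have "b - 3 * m - 1 = b - 1 - 3 * m" by simp
    ultimately show "q powi (3 * m\<^sup>2 + s * m) * qbin (Suc L) (b - 3 * m) =
        q powi (3 * m\<^sup>2 + s * m) * qbin L ((b - 1) - 3 * m)
        + q powi b * (q powi (3 * m\<^sup>2 + (s - 3) * m) * qbin L (b - 3 * m))"
      by (simp only: qbin_pascal distrib_left mult.assoc[symmetric])
  qed
  also have "\<dots> = qbin_theta s L (b - 1) + q powi b * qbin_theta (s - 3) L b"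
    unfolding qbin_theta_def by (subst infsum_add) (intro qbin_summable summable_on_cmult_right | simp add: infsum_cmult_right')+
  finally show ?thesis .
qed

text \<open>The mirror image of the first rule: reflect, apply it, and reflect back.\<close>

lemma qbin_theta_pascal': "qbin_theta s (Suc L) b = qbin_theta s L b + q powi (int L + 1 - b) * qbin_theta (s + 3) L (b - 1)"
  using qbin_theta_pascal[of "- s" L "int L + 1 - b"] qbin_theta_neg[of s "Suc L" b] qbin_theta_neg[of s L b]
    qbin_theta_neg[of "s + 3" L "b - 1"]
  by (simp add: algebra_simps)

section \<open>Closed forms by lowering L\<close>

text \<open>The first Pascal rule on the first sum and the second rule on the second both produce
  \<open>qbin_theta 2 (2 * N) (int N - 1)\<close>, which cancels. Shift and reflection bring the
  other two sums to the stated form.\<close>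

lemma qbin_theta_odd_step:
  "qbin_theta 2 (2 * N + 1) N - qbin_theta 2 (2 * N + 1) (int N - 1) = q ^ N * (qbin_theta 1 (2 * N) N - qbin_theta 1 (2 * N) (int N - 1))"
proof -
  have "int (2 * N) + 1 - (int N - 1) = int N + 2" by simp
  hence "q powi (int (2 * N) + 1 - (int N - 1)) * qbin_theta 5 (2 * N) (int N - 2)
      = q ^ N * (q powi 2 * qbin_theta 5 (2 * N) (int N - 2))"
    by (simp only: q_powi_add power_int_of_nat mult.assoc)
  also have "q powi 2 * qbin_theta 5 (2 * N) (int N - 2) = qbin_theta (- 1) (2 * N) (int N + 1)"
    using qbin_theta_shift[of "- 1" "2 * N" "int N + 1"] by simp
  finally show ?thesis
    using qbin_theta_pascal[of 2 "2 * N" "int N"] qbin_theta_pascal'[of 2 "2 * N" "int N - 1"]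
      qbin_theta_neg[of 1 "2 * N" "int N"] qbin_theta_neg[of 1 "2 * N" "int N - 1"]
    by (simp add: algebra_simps)
qed

text \<open>The same scheme, with \<open>qbin_theta 1 (2 * N + 1) N\<close> cancelling.\<close>

lemma qbin_theta_even_step:
  "qbin_theta 1 (2 * N + 2) (int N + 1) - qbin_theta 1 (2 * N + 2) N =
     q ^ (N + 1) * (qbin_theta 2 (2 * N + 1) N - qbin_theta 2 (2 * N + 1) (int N - 1))"
proof -
  have "int (2 * N + 1) + 1 - int N = int (N + 1) + 1" by simp
  hence "q powi (int (2 * N + 1) + 1 - int N) * qbin_theta 4 (2 * N + 1) (int N - 1)
      = q ^ (N + 1) * (q powi 1 * qbin_theta 4 (2 * N + 1) (int N - 1))"
    by (simp only: q_powi_add power_int_of_nat mult.assoc)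
  also have "q powi 1 * qbin_theta 4 (2 * N + 1) (int N - 1) = qbin_theta (- 2) (2 * N + 1) (int N + 2)"
    using qbin_theta_shift[of "- 2" "2 * N + 1" "int N + 2"] by simp
  finally show ?thesis
    using qbin_theta_pascal[of 1 "2 * N + 1" "int N + 1"] qbin_theta_pascal'[of 1 "2 * N + 1" "int N"]
      qbin_theta_neg[of 2 "2 * N + 1" "int N"] qbin_theta_neg[of 2 "2 * N + 1" "int N - 1"]
      power_int_of_nat[of q "N + 1"]
    by (simp add: algebra_simps)
qed

lemma qbin_theta_0: "qbin_theta 1 0 0 - qbin_theta 1 0 (- 1) = 1"
proof -
  have "qbin_theta 1 0 0 = (\<Sum>\<^sub>\<infinity>m\<in>{0}. q powi (3 * m\<^sup>2 + 1 * m) * qbin 0 (0 - 3 * m))"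
    unfolding qbin_theta_def by (rule infsum_cong_neutral) (auto simp: qbin_def)
  hence 1: "qbin_theta 1 0 0 = 1" by (simp add: qbin_def)
  \<comment> \<open>Since 3 does not divide 1, the lower index is never 0.\<close>
  have "qbin 0 (- 1 - 3 * m) = 0" for m
    unfolding qbin_def by (simp, presburger)
  hence "qbin_theta 1 0 (- 1) = 0" by (simp add: qbin_theta_def)
  with 1 show ?thesis by simp
qed

text \<open>An even step followed by an odd step contributes q^(N+1) q^N, and 2N + 1 is the
  difference of consecutive squares.\<close>

lemma qbin_theta_even: "qbin_theta 1 (2 * N) N - qbin_theta 1 (2 * N) (int N - 1) = q ^ (N\<^sup>2)"
proof (induction N)
  case 0
  thus ?case using qbin_theta_0 by simp
next
  case (Suc N)
  have "q ^ (N + 1) * (q ^ N * q ^ (N\<^sup>2)) = q ^ ((Suc N)\<^sup>2)"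
    unfolding power_add[symmetric] by (intro arg_cong[of _ _ "\<lambda>n. q ^ n"]) (simp add: power2_eq_square)
  thus ?case using qbin_theta_even_step[of N] qbin_theta_odd_step[of N] Suc.IH by (simp add: add.commute)
qed

text \<open>The odd step combined with the even closed form. Shift and reflection rewrite the second
  sum with linear coefficient 4, which leads to the exponents of the second identity.\<close>

lemma qbin_theta_odd_F1: "qbin_theta 2 (2 * N + 1) N - q * qbin_theta 4 (2 * N + 1) (int N - 1) = q ^ (N\<^sup>2 + N)"
  using qbin_theta_odd_step[of N] qbin_theta_even[of N] qbin_theta_shift[of "- 2" "2 * N + 1" "int N + 2"]
    qbin_theta_neg[of "- 2" "2 * N + 1" "int N + 2"]
  by (simp add: power_add mult.commute)

text \<open>By a shift, the subtracted sum is
  \<open>qbin_theta (- 1) (2 * N + 1) (int N + 2)\<close>. The first Pascal rule on it and the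
  second rule on the other sum share the term with \<open>qbin_theta 2 (2 * N) (int N - 1)\<close>.
  What remains is the even closed form, reflected.\<close>

lemma qbin_theta_odd_F2: "qbin_theta (- 1) (2 * N + 1) N - q\<^sup>2 * qbin_theta 5 (2 * N + 1) (int N - 1) = q ^ (N\<^sup>2)"
proof -
  have "q powi (int N + 2) * qbin_theta (- 4) (2 * N) (int N + 2)
      = q powi (int N + 2) * (q powi (- 1) * qbin_theta 2 (2 * N) (int N - 1))"
    using qbin_theta_shift[of "- 4" "2 * N" "int N + 2"] by simp
  also have "\<dots> = q powi (int N + 1) * qbin_theta 2 (2 * N) (int N - 1)"
    using q0 by (simp add: power_int_add power2_eq_square)
  finally have "qbin_theta (- 1) (2 * N + 1) (int N + 2)
      = qbin_theta (- 1) (2 * N) (int N + 1) + q powi (int N + 1) * qbin_theta 2 (2 * N) (int N - 1)"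
    using qbin_theta_pascal[of "- 1" "2 * N" "int N + 2"] by (simp add: add.commute)
  moreover have "qbin_theta (- 1) (2 * N + 1) (int N + 2) = q\<^sup>2 * qbin_theta 5 (2 * N + 1) (int N - 1)"
    using qbin_theta_shift[of "- 1" "2 * N + 1" "int N + 2"] by simp
  ultimately have 1: "q\<^sup>2 * qbin_theta 5 (2 * N + 1) (int N - 1)
      = qbin_theta (- 1) (2 * N) (int N + 1) + q powi (int N + 1) * qbin_theta 2 (2 * N) (int N - 1)"
    by (rule trans[OF sym, rotated])
  have 2: "qbin_theta (- 1) (2 * N + 1) N = qbin_theta (- 1) (2 * N) N + q powi (int N + 1) * qbin_theta 2 (2 * N) (int N - 1)"
    using qbin_theta_pascal'[of "- 1" "2 * N" "int N"] by simp
  have "qbin_theta (- 1) (2 * N) N - qbin_theta (- 1) (2 * N) (int N + 1) = q ^ (N\<^sup>2)"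
    using qbin_theta_even[of N] qbin_theta_neg[of 1 "2 * N" "int N"] qbin_theta_neg[of 1 "2 * N" "int N - 1"] by simp
  thus ?thesis unfolding 1 2 by simp
qed

text \<open>The even closed form at N + 1 is expanded with the two Pascal rules interchanged
  compared with the even step. The two sums with coefficient 1 no longer cancel; their difference is
  q^(N^2) by \<open>qbin_theta_odd_F2\<close>.\<close>

lemma qbin_theta_odd_F0:
  "q ^ N * (qbin_theta (- 2) (2 * N + 1) N - q * qbin_theta 4 (2 * N + 1) N) = q ^ (N\<^sup>2) * (1 - q ^ (2 * N + 1))"
proof -
  have "qbin_theta 1 (2 * N + 2) (int N + 1) - qbin_theta 1 (2 * N + 2) N = q ^ (N\<^sup>2) * q ^ (2 * N + 1)"
  proof -
    have "(Suc N)\<^sup>2 = N\<^sup>2 + (2 * N + 1)" by (simp add: power2_eq_square)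
    hence "q ^ ((Suc N)\<^sup>2) = q ^ (N\<^sup>2) * q ^ (2 * N + 1)" by (simp only: power_add)
    thus ?thesis using qbin_theta_even[of "Suc N"] by (simp add: add.commute)
  qed
  moreover have "qbin_theta 1 (2 * N + 2) (int N + 1) = qbin_theta 1 (2 * N + 1) (int N + 1) + q ^ N * (q * qbin_theta 4 (2 * N + 1) N)"
    using qbin_theta_pascal'[of 1 "2 * N + 1" "int N + 1"] power_int_of_nat[of q "Suc N"] by (simp add: mult_ac add_ac)
  moreover have "qbin_theta 1 (2 * N + 2) N = qbin_theta 1 (2 * N + 1) (int N - 1) + q ^ N * qbin_theta (- 2) (2 * N + 1) N"
    using qbin_theta_pascal[of 1 "2 * N + 1" "int N"] by simp
  moreover have "qbin_theta 1 (2 * N + 1) (int N + 1) - qbin_theta 1 (2 * N + 1) (int N - 1) = q ^ (N\<^sup>2)"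
    using qbin_theta_odd_F2[of N] qbin_theta_shift[of "- 1" "2 * N + 1" "int N + 2"]
      qbin_theta_neg[of 1 "2 * N + 1" "int N + 1"] qbin_theta_neg[of 1 "2 * N + 1" "int N - 1"]
    by simp
  ultimately show ?thesis by (simp add: algebra_simps)
qed

section \<open>The three identities for nonzero \<open>q\<close>\<close>

lemma norm_q_powi_le: "e \<ge> 0 \<Longrightarrow> norm (q powi e) \<le> 1"
  using norm_q_power_le[of "nat e"] by (simp add: power_int_def)

text \<open>Multiplied by (q)_{2N+1}, the Bailey kernel at r = \<open>rho d m\<close> is a Gaussian
  binomial. Its lower index N - d - 3m equals N - r for m \<ge> 0 and the mirror index N + r + 1 for
  m < 0.\<close>

lemma bailey_pair_qbin:
  assumes d: "d \<in> {0, 1}"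
  shows "(\<Sum>m | rho d m \<le> N. c m / (qfact q (N - rho d m) * qfact q (N + rho d m + 1)))
     = (\<Sum>\<^sub>\<infinity>m. c m * qbin (2 * N + 1) (int N - d - 3 * m)) / qfact q (2 * N + 1)"
proof -
  have fin: "finite {m. rho d m \<le> N}"
    by (rule finite_rho_le[OF d])
  have "(\<Sum>\<^sub>\<infinity>m. c m * qbin (2 * N + 1) (int N - d - 3 * m)) =
      (\<Sum>\<^sub>\<infinity>m\<in>{m. rho d m \<le> N}. c m * (qfact q (2 * N + 1) / (qfact q (N - rho d m) * qfact q (N + rho d m + 1))))"
  proof (rule infsum_cong_neutral)
    fix m assume "m \<in> UNIV - {m. rho d m \<le> N}"
    thus "c m * qbin (2 * N + 1) (int N - d - 3 * m) = 0"
      by (auto simp: rho_le_iff[OF d] qbin_def)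
  next
    fix m assume "m \<in> UNIV \<inter> {m. rho d m \<le> N}"
    hence m: "- int (Suc N) - d \<le> 3 * m" "3 * m \<le> int N - d" by (auto simp: rho_le_iff[OF d])
    show "c m * qbin (2 * N + 1) (int N - d - 3 * m) =
        c m * (qfact q (2 * N + 1) / (qfact q (N - rho d m) * qfact q (N + rho d m + 1)))"
    proof (cases "m \<ge> 0")
      case True
      hence "nat (int N - d - 3 * m) = N - rho d m"
        "nat (int (2 * N + 1) - (int N - d - 3 * m)) = N + rho d m + 1"
        using d by (auto simp: rho_def)
      thus ?thesis using m True d by (auto simp: qbin_def)
    next
      case False
      hence "nat (int N - d - 3 * m) = N + rho d m + 1"
        "nat (int (2 * N + 1) - (int N - d - 3 * m)) = N - rho d m"
        using m d by (auto simp: rho_def)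
      thus ?thesis using m False d by (auto simp: qbin_def mult.commute)
    qed
  qed auto
  thus ?thesis
    using fin qfact_nonzero[of "2 * N + 1"] by (simp add: sum_divide_distrib)
qed

text \<open>The condition on \<open>E\<close> is the doubled form of E = e + r + j(3j-1)/2 -
  (r+1)(3r+2)/2, the total exponent of the left side when j = n + 1.\<close>

lemma pent_tail_term_powi:
  assumes "r \<le> n" and j: "j = int (Suc n)"
    and E: "2 * E = 2 * e + j * (3 * j - 1) - (3 * (int r)\<^sup>2 + 3 * int r + 2)"
  shows "q powi e * q ^ r * pent_tail_term q (Suc r) (n - r)
    = (- 1) powi (j + int r + 1) * q powi E * (1 + q powi j)"
proof -
  define k where "k = n - r"
  have n: "n = r + k" using assms by (simp add: k_def)
  have p: "2 * int (pent k) = int k * (3 * int k - 1)"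
    unfolding pent_int by simp
  have "E = e + int (r + (3 * Suc r * k + pent k))"
    using E p by (simp add: j n power2_eq_square algebra_simps)
  hence "q powi E = q powi e * (q ^ r * q ^ (3 * Suc r * k + pent k))"
    using q0 by (simp only: power_int_add power_int_of_nat power_add simp_thms)
  moreover have "q powi j = q ^ (Suc r + k)"
    by (simp add: j n power_int_def nat_add_distrib del: power_Suc)
  moreover have "(- 1 :: complex) ^ k = (- 1) powi (j + int r + 1)"
  proof -
    have "j + int r + 1 = int (k + 2 * Suc r)" by (simp add: j n)
    hence "(- 1 :: complex) powi (j + int r + 1) = (- 1) ^ (k + 2 * Suc r)"
      by (simp only: power_int_of_nat)
    thus ?thesis by (simp add: power_add power_mult)
  qed
  ultimately show ?thesis unfolding pent_tail_term_def k_def[symmetric] by (simp add: mult_ac)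
qed

text \<open>The quadratic 3r(r+1) is invariant under r -> -1-r, so \<open>rho d m\<close> may be
  replaced by 3m + d for either sign of m. The parity of r does change, which is the source of
  \<open>sg m\<close>; the factor (-1)^d absorbs the shift by d.\<close>

lemma pent_tail_term_rho:
  assumes d: "d \<in> {0, 1}" and "rho d m \<le> n" and j: "j = int (Suc n)"
    and E: "2 * E = 2 * e + j * (3 * j - 1) - (3 * (3 * m + d)\<^sup>2 + 3 * (3 * m + d) + 2)"
  shows "(- 1) powi d * q powi e * q ^ rho d m * pent_tail_term q (Suc (rho d m)) (n - rho d m)
    = sg m * (- 1) powi (m + j + 1) * q powi E * (1 + q powi j)"
proof -
  have r: "int (rho d m) = (if m \<ge> 0 then 3 * m + d else - 3 * m - 1 - d)"
    using d by (auto simp: rho_def)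
  have "2 * E = 2 * e + j * (3 * j - 1) - (3 * (int (rho d m))\<^sup>2 + 3 * int (rho d m) + 2)"
    using E unfolding r by (simp add: power2_eq_square algebra_simps)
  from pent_tail_term_powi[OF assms(2) j this] show ?thesis
    using d by (auto simp: r sg_def minus_one_powi mult.assoc)
qed

lemma bailey_qbin:
  assumes d: "d \<in> {0, 1}" and a: "\<And>m. norm (a m) \<le> C"
    and \<beta>: "\<And>n. (\<Sum>\<^sub>\<infinity>m. a m * qbin (2 * n + 1) (int n - d - 3 * m)) = \<beta> n * qfact q (2 * n + 1)"
    and g: "\<And>n m. rho d m \<le> n \<Longrightarrow>
      a m * q ^ rho d m * pent_tail_term q (Suc (rho d m)) (n - rho d m) = g (int (Suc n)) m"
  shows "(\<lambda>n. q ^ n * qfact q n * \<beta> n) summable_on UNIV"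
    and "(\<Sum>\<^sub>\<infinity>j\<in>{1 + d..}. \<Sum>m | - j - d \<le> 3 * m \<and> 3 * m \<le> j - 1 - d. g j m) =
      qpoch_inf q * (\<Sum>\<^sub>\<infinity>n. q ^ n * qfact q n * \<beta> n)"
proof -
  have eq: "(\<Sum>m | rho d m \<le> n. a m / (qfact q (n - rho d m) * qfact q (n + rho d m + 1))) = \<beta> n" for n
    unfolding bailey_pair_qbin[OF d] \<beta> using qfact_nonzero[of "2 * n + 1"] by simp
  note * = bailey_sum[where \<rho> = "rho d" and a = a, OF rho_summable[OF d norm_ge_zero q] finite_rho_le[OF d] a]
  show "(\<lambda>n. q ^ n * qfact q n * \<beta> n) summable_on UNIV"
    using *(1) unfolding eq .
  have "(\<Sum>\<^sub>\<infinity>j\<in>{1 + d..}. \<Sum>m | - j - d \<le> 3 * m \<and> 3 * m \<le> j - 1 - d. g j m) =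
      (\<Sum>\<^sub>\<infinity>j\<in>{1..}. \<Sum>m | - j - d \<le> 3 * m \<and> 3 * m \<le> j - 1 - d. g j m)"
  proof (rule infsum_cong_neutral)
    \<comment> \<open>For d = 1 and j = 1 the range -2 \<le> 3m \<le> -1 is empty, so the sum may
      start at j = 2.\<close>
    fix j :: int assume "j \<in> {1..} - {1 + d..}"
    hence "j = 1" "d = 1" using d by auto
    hence "{m. - j - d \<le> 3 * m \<and> 3 * m \<le> j - 1 - d} = {}" by (simp, presburger)
    thus "(\<Sum>m | - j - d \<le> 3 * m \<and> 3 * m \<le> j - 1 - d. g j m) = 0" by (simp only: sum.empty)
  qed (use d in auto)
  also have "\<dots> = qpoch_inf q * (\<Sum>\<^sub>\<infinity>n. q ^ n * qfact q n * \<beta> n)"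
    by (rule infsum_from_1[OF *(2)[unfolded eq]]) (simp only: rho_le_iff[OF d, symmetric], intro sum.cong refl, rule g, simp)
  finally show "(\<Sum>\<^sub>\<infinity>j\<in>{1 + d..}. \<Sum>m | - j - d \<le> 3 * m \<and> 3 * m \<le> j - 1 - d. g j m) =
      qpoch_inf q * (\<Sum>\<^sub>\<infinity>n. q ^ n * qfact q n * \<beta> n)" .
qed

lemma qpoch_quotient: "qpoch (q ^ (m + 1)) q n = qfact q (m + n) / qfact q m"
  using qpoch_shift[of q m n] qfact_nonzero[of m] by (simp add: field_simps)

lemma powi_q_mult: "q powi e * q ^ k = q powi (e + int k)"
  using q0 by (simp add: power_int_add)

lemma qbin_theta_scaled:
  assumes "\<And>m. e m = 3 * m\<^sup>2 + s * m + int k"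
  shows "(\<Sum>\<^sub>\<infinity>m. q powi e m * qbin L (b - 3 * m)) = q ^ k * qbin_theta s L b"
proof -
  have "q powi e m * qbin L (b - 3 * m)
      = q ^ k * (q powi (3 * m\<^sup>2 + s * m) * qbin L (b - 3 * m))" for m
    unfolding assms powi_q_mult[symmetric] by (simp only: mult_ac)
  thus ?thesis by (simp only: qbin_theta_def infsum_cmult_right')
qed

section \<open>The three functions\<close>

text \<open>Both families of \<open>qbin_theta_odd_F0\<close> have the index offset d = 0, so they
  merge into one coefficient \<open>a\<close>. Their exponents differ by 6m + 1, which yields the
  factor 1 - q^(6m+1).\<close>

lemma mock_F0_identity:
  "qpoch_inf q * mock_F0 q =
    (\<Sum>\<^sub>\<infinity>j\<in>{1::int..}. \<Sum>m | - j \<le> 3 * m \<and> 3 * m \<le> j - 1.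
      sg m * (- 1) powi (m + j + 1) *
      q powi ((j * (3 * j - 1)) div 2 - (m * (21 * m + 13)) div 2 - 1) *
      (1 + q powi j) * (1 - q powi (6 * m + 1)))" (is "_ = (\<Sum>\<^sub>\<infinity>j\<in>{1..}. \<Sum>m | _. ?g j m)")
proof -
  define a where "a = (\<lambda>m. q powi (3 * m\<^sup>2 - 2 * m) - q powi (3 * m\<^sup>2 + 4 * m + 1))"
  define \<beta> where "\<beta> = (\<lambda>n. q ^ (n\<^sup>2) / (q ^ n * qfact q (2 * n)))"
  have a_bound: "norm (a m) \<le> 2" for m
  proof -
    have "norm (a m) \<le> norm (q powi (3 * m\<^sup>2 - 2 * m)) + norm (q powi (3 * m\<^sup>2 + 4 * m + 1))"
      unfolding a_def by (rule norm_triangle_ineq4)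
    also have "\<dots> \<le> 1 + 1"
      by (intro add_mono norm_q_powi_le quadratic_nonneg)
    finally show ?thesis by simp
  qed
  have beta: "(\<Sum>\<^sub>\<infinity>m. a m * qbin (2 * n + 1) (int n - 0 - 3 * m)) = \<beta> n * qfact q (2 * n + 1)" for n
  proof -
    have "(\<Sum>\<^sub>\<infinity>m. a m * qbin (2 * n + 1) (int n - 0 - 3 * m)) =
        (\<Sum>\<^sub>\<infinity>m. q powi (3 * m\<^sup>2 - 2 * m) * qbin (2 * n + 1) (int n - 3 * m)
          + - (q powi (3 * m\<^sup>2 + 4 * m + 1)) * qbin (2 * n + 1) (int n - 3 * m))"
      by (simp add: a_def left_diff_distrib)
    also have "\<dots> = (\<Sum>\<^sub>\<infinity>m. q powi (3 * m\<^sup>2 - 2 * m) * qbin (2 * n + 1) (int n - 3 * m))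
          + (\<Sum>\<^sub>\<infinity>m. - (q powi (3 * m\<^sup>2 + 4 * m + 1)) * qbin (2 * n + 1) (int n - 3 * m))"
      by (intro infsum_add qbin_summable)
    also have "\<dots> = qbin_theta (- 2) (2 * n + 1) n - q * qbin_theta 4 (2 * n + 1) n"
      using qbin_theta_scaled[of "\<lambda>m. 3 * m\<^sup>2 - 2 * m" "- 2" 0] qbin_theta_scaled[of "\<lambda>m. 3 * m\<^sup>2 + 4 * m + 1" 4 1]
      by (simp add: infsum_uminus)
    also have "\<dots> = \<beta> n * qfact q (2 * n + 1)"
    proof -
      have "qbin_theta (- 2) (2 * n + 1) n - q * qbin_theta 4 (2 * n + 1) n = q ^ (n\<^sup>2) * (1 - q ^ (2 * n + 1)) / q ^ n"
        using qbin_theta_odd_F0[of n] q0 by (simp add: eq_divide_eq mult.commute)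
      moreover have "qfact q (2 * n + 1) = qfact q (2 * n) * (1 - q ^ (2 * n + 1))"
        using qfact_Suc[of q "2 * n"] by simp
      ultimately show ?thesis
        using q0 qfact_nonzero[of "2 * n"] by (simp add: \<beta>_def del: power_Suc)
    qed
    finally show ?thesis .
  qed
  have g: "a m * q ^ rho 0 m * pent_tail_term q (Suc (rho 0 m)) (n - rho 0 m) = ?g (int (Suc n)) m"
    if "rho 0 m \<le> n" for n m
  proof -
    define j where "j = int (Suc n)"
    define E where "E = (j * (3 * j - 1)) div 2 - (m * (21 * m + 13)) div 2 - 1"
    have "2 * E = 2 * (3 * m\<^sup>2 - 2 * m) + j * (3 * j - 1) - (3 * (3 * m + 0)\<^sup>2 + 3 * (3 * m + 0) + 2)"
      unfolding E_def by (simp add: twice_exponent power2_eq_square algebra_simps)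
    note * = pent_tail_term_rho[OF _ that j_def this, simplified]
    have "3 * m\<^sup>2 + 4 * m + 1 = (3 * m\<^sup>2 - 2 * m) + (6 * m + 1)" by simp
    hence "a m = q powi (3 * m\<^sup>2 - 2 * m) * (1 - q powi (6 * m + 1))"
      unfolding a_def using q0 by (simp only: power_int_add simp_thms) (simp add: algebra_simps)
    thus ?thesis
      using * unfolding j_def[symmetric] E_def[symmetric] by (simp add: mult_ac)
  qed
  have "qpoch (q ^ (n + 1)) q n = qfact q (2 * n) / qfact q n" for n
    using qpoch_quotient[of n n] by (simp add: mult_2)
  hence "mock_F0 q = (\<Sum>\<^sub>\<infinity>n. q ^ n * qfact q n * \<beta> n)"
    unfolding mock_F0_def atLeast_0
    using q0 by (intro infsum_cong) (simp add: \<beta>_def)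
  thus ?thesis
    using bailey_qbin(2)[OF _ a_bound beta g] by simp
qed

text \<open>The families have offsets d = 0 and d = 1, so each is summed separately and
  \<open>\<beta>\<close> is split as \<open>S0 + S1\<close>. The minus sign of the second family is
  the factor (-1)^d. The quadratics 27m^2 + 9m + 2 and 27m^2 + 27m + 8 are 3x^2 + 3x + 2 at x = 3m
  and x = 3m + 1.\<close>

lemma bailey_two_term:
  assumes e0: "\<And>m. e0 m \<ge> 0" and e1: "\<And>m. e1 m \<ge> 0"
    and \<beta>: "\<And>n. (\<Sum>\<^sub>\<infinity>m. q powi e0 m * qbin (2 * n + 1) (int n - 3 * m))
      - (\<Sum>\<^sub>\<infinity>m. q powi e1 m * qbin (2 * n + 1) (int n - 1 - 3 * m)) = \<beta> n * qfact q (2 * n + 1)"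
    and E0: "\<And>j m. 2 * E0 j m = 2 * e0 m + j * (3 * j - 1) - (27 * m\<^sup>2 + 9 * m + 2)"
    and E1: "\<And>j m. 2 * E1 j m = 2 * e1 m + j * (3 * j - 1) - (27 * m\<^sup>2 + 27 * m + 8)"
  shows "qpoch_inf q * (\<Sum>\<^sub>\<infinity>n. q ^ n * qfact q n * \<beta> n) =
     (\<Sum>\<^sub>\<infinity>j\<in>{1::int..}. \<Sum>m | - j \<le> 3 * m \<and> 3 * m \<le> j - 1.
        sg m * (- 1) powi (m + j + 1) * q powi E0 j m * (1 + q powi j))
     + (\<Sum>\<^sub>\<infinity>j\<in>{2::int..}. \<Sum>m | - j - 1 \<le> 3 * m \<and> 3 * m \<le> j - 2.
        sg m * (- 1) powi (m + j + 1) * q powi E1 j m * (1 + q powi j))"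
proof -
  define S0 where "S0 n = (\<Sum>\<^sub>\<infinity>m. q powi e0 m * qbin (2 * n + 1) (int n - 3 * m)) / qfact q (2 * n + 1)" for n
  define S1 where "S1 n = (\<Sum>\<^sub>\<infinity>m. - (q powi e1 m) * qbin (2 * n + 1) (int n - 1 - 3 * m)) / qfact q (2 * n + 1)" for n
  have nz: "qfact q (2 * n + 1) \<noteq> 0" for n
    by (rule qfact_nonzero)
  have g0: "q powi e0 m * q ^ rho 0 m * pent_tail_term q (Suc (rho 0 m)) (n - rho 0 m)
      = sg m * (- 1) powi (m + int (Suc n) + 1) * q powi E0 (int (Suc n)) m * (1 + q powi int (Suc n))"
    if "rho 0 m \<le> n" for n m
    using pent_tail_term_rho[OF _ that refl, of "E0 (int (Suc n)) m" "e0 m"] E0[of "int (Suc n)" m]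
    by (simp add: power2_eq_square)
  have g1: "- (q powi e1 m) * q ^ rho 1 m * pent_tail_term q (Suc (rho 1 m)) (n - rho 1 m)
      = sg m * (- 1) powi (m + int (Suc n) + 1) * q powi E1 (int (Suc n)) m * (1 + q powi int (Suc n))"
    if "rho 1 m \<le> n" for n m
  proof -
    have "2 * E1 (int (Suc n)) m = 2 * e1 m + int (Suc n) * (3 * int (Suc n) - 1)
        - (3 * (3 * m + 1)\<^sup>2 + 3 * (3 * m + 1) + 2)"
      unfolding E1 by (simp add: power2_eq_square algebra_simps)
    from pent_tail_term_rho[OF _ that refl this] show ?thesis by simp
  qed
  have b0: "(\<Sum>\<^sub>\<infinity>m. q powi e0 m * qbin (2 * n + 1) (int n - 0 - 3 * m)) = S0 n * qfact q (2 * n + 1)" for n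
    using nz by (simp add: S0_def)
  have b1: "(\<Sum>\<^sub>\<infinity>m. - (q powi e1 m) * qbin (2 * n + 1) (int n - 1 - 3 * m)) = S1 n * qfact q (2 * n + 1)" for n
    using nz by (simp add: S1_def)
  have n0: "norm (q powi e0 m) \<le> 1" and n1: "norm (- (q powi e1 m)) \<le> 1" for m
    using norm_q_powi_le e0 e1 by simp_all
  note r0 = bailey_qbin[where d = 0, OF _ n0 b0 g0, simplified]
  note r1 = bailey_qbin[where d = 1, OF _ n1 b1 g1, simplified]
  have "\<beta> n = S0 n + S1 n" for n
    using \<beta>[of n] nz[of n] by (simp add: S0_def S1_def infsum_uminus field_simps)
  hence "(\<Sum>\<^sub>\<infinity>n. q ^ n * qfact q n * \<beta> n)
      = (\<Sum>\<^sub>\<infinity>n. q ^ n * qfact q n * S0 n) + (\<Sum>\<^sub>\<infinity>n. q ^ n * qfact q n * S1 n)"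
    using r0(1) r1(1) by (simp add: distrib_left infsum_add)
  thus ?thesis using r0(2) r1(2) by (simp add: distrib_left)
qed

text \<open>The sum is reindexed to start at 0, and (n+1)^2 = n + (n^2 + n + 1). Hence
  \<open>\<beta>\<close> carries one factor q more than \<open>qbin_theta_odd_F1\<close>, and both
  exponents are raised by 1.\<close>

lemma mock_F1_identity:
  "qpoch_inf q * mock_F1 q =
     (\<Sum>\<^sub>\<infinity>j\<in>{1::int..}. \<Sum>m | - j \<le> 3 * m \<and> 3 * m \<le> j - 1.
        sg m * (- 1) powi (m + j + 1) *
        q powi ((j * (3 * j - 1)) div 2 - (m * (21 * m + 5)) div 2) * (1 + q powi j))
     + (\<Sum>\<^sub>\<infinity>j\<in>{2::int..}. \<Sum>m | - j - 1 \<le> 3 * m \<and> 3 * m \<le> j - 2.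
        sg m * (- 1) powi (m + j + 1) *
        q powi ((j * (3 * j - 1)) div 2 - (m * (21 * m + 19)) div 2 - 2) * (1 + q powi j))"
proof -
  define \<beta> where "\<beta> = (\<lambda>n. q ^ (n\<^sup>2 + n + 1) / qfact q (2 * n + 1))"
  have "mock_F1 q = (\<Sum>\<^sub>\<infinity>n. q ^ ((Suc n)\<^sup>2) / qpoch (q ^ Suc n) q (Suc n))"
    unfolding mock_F1_def
    by (rule infsum_reindex_bij_betw[symmetric], rule bij_betw_byWitness[where f' = "\<lambda>n. n - 1"]) auto
  also have "\<dots> = (\<Sum>\<^sub>\<infinity>n. q ^ n * qfact q n * \<beta> n)"
  proof (rule infsum_cong)
    fix n
    have "qpoch (q ^ Suc n) q (Suc n) = qfact q (2 * n + 1) / qfact q n"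
      using qpoch_quotient[of n "Suc n"] by (simp flip: mult_2)
    moreover have "q ^ ((Suc n)\<^sup>2) = q ^ n * q ^ (n\<^sup>2 + n + 1)"
      unfolding power_add[symmetric] by (rule arg_cong[of _ _ "\<lambda>k. q ^ k"]) (simp add: power2_eq_square)
    ultimately show "q ^ ((Suc n)\<^sup>2) / qpoch (q ^ Suc n) q (Suc n) = q ^ n * qfact q n * \<beta> n"
      by (simp add: \<beta>_def)
  qed
  finally have F1: "mock_F1 q = (\<Sum>\<^sub>\<infinity>n. q ^ n * qfact q n * \<beta> n)" .
  show ?thesis
    unfolding F1
  proof (rule bailey_two_term[where ?e0.0 = "\<lambda>m. 3 * m\<^sup>2 + 2 * m + 1" and ?e1.0 = "\<lambda>m. 3 * m\<^sup>2 + 4 * m + 2"])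
    fix m :: int
    show "0 \<le> 3 * m\<^sup>2 + 2 * m + 1" "0 \<le> 3 * m\<^sup>2 + 4 * m + 2"
      by (rule quadratic_nonneg)+
  next
    fix n
    show "(\<Sum>\<^sub>\<infinity>m. q powi (3 * m\<^sup>2 + 2 * m + 1) * qbin (2 * n + 1) (int n - 3 * m))
        - (\<Sum>\<^sub>\<infinity>m. q powi (3 * m\<^sup>2 + 4 * m + 2) * qbin (2 * n + 1) (int n - 1 - 3 * m)) = \<beta> n * qfact q (2 * n + 1)"
      using qbin_theta_scaled[of "\<lambda>m. 3 * m\<^sup>2 + 2 * m + 1" 2 1] qbin_theta_scaled[of "\<lambda>m. 3 * m\<^sup>2 + 4 * m + 2" 4 2]
        qbin_theta_odd_F1[of n] qfact_nonzero[of "2 * n + 1"]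
      by (simp add: \<beta>_def power_add power2_eq_square mult.assoc flip: right_diff_distrib)
  next
    fix j m :: int
    show "2 * (j * (3 * j - 1) div 2 - m * (21 * m + 5) div 2)
        = 2 * (3 * m\<^sup>2 + 2 * m + 1) + j * (3 * j - 1) - (27 * m\<^sup>2 + 9 * m + 2)"
      using twice_exponent[of 5 j m 0] by (simp add: power2_eq_square algebra_simps)
    show "2 * (j * (3 * j - 1) div 2 - m * (21 * m + 19) div 2 - 2)
        = 2 * (3 * m\<^sup>2 + 4 * m + 2) + j * (3 * j - 1) - (27 * m\<^sup>2 + 27 * m + 8)"
      by (simp add: twice_exponent power2_eq_square algebra_simps)
  qed
qed

lemma mock_F2_identity:
  "qpoch_inf q * mock_F2 q =
     (\<Sum>\<^sub>\<infinity>j\<in>{1::int..}. \<Sum>m | - j \<le> 3 * m \<and> 3 * m \<le> j - 1.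
        sg m * (- 1) powi (m + j + 1) *
        q powi ((j * (3 * j - 1)) div 2 - (m * (21 * m + 11)) div 2 - 1) * (1 + q powi j))
     + (\<Sum>\<^sub>\<infinity>j\<in>{2::int..}. \<Sum>m | - j - 1 \<le> 3 * m \<and> 3 * m \<le> j - 2.
        sg m * (- 1) powi (m + j + 1) *
        q powi ((j * (3 * j - 1)) div 2 - (m * (21 * m + 17)) div 2 - 2) * (1 + q powi j))"
proof -
  define \<beta> where "\<beta> = (\<lambda>n. q ^ (n\<^sup>2) / qfact q (2 * n + 1))"
  have "qpoch (q ^ (n + 1)) q (n + 1) = qfact q (2 * n + 1) / qfact q n" for n
    using qpoch_quotient[of n "Suc n"] by (simp flip: mult_2)
  hence F2: "mock_F2 q = (\<Sum>\<^sub>\<infinity>n. q ^ n * qfact q n * \<beta> n)"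
    unfolding mock_F2_def atLeast_0 by (intro infsum_cong) (simp add: \<beta>_def power_add mult_ac)
  show ?thesis
    unfolding F2
  proof (rule bailey_two_term[where ?e0.0 = "\<lambda>m. 3 * m\<^sup>2 - m" and ?e1.0 = "\<lambda>m. 3 * m\<^sup>2 + 5 * m + 2"])
    fix m :: int
    show "0 \<le> 3 * m\<^sup>2 - m" "0 \<le> 3 * m\<^sup>2 + 5 * m + 2"
      by (rule quadratic_nonneg)+
  next
    fix n
    show "(\<Sum>\<^sub>\<infinity>m. q powi (3 * m\<^sup>2 - m) * qbin (2 * n + 1) (int n - 3 * m))
        - (\<Sum>\<^sub>\<infinity>m. q powi (3 * m\<^sup>2 + 5 * m + 2) * qbin (2 * n + 1) (int n - 1 - 3 * m)) = \<beta> n * qfact q (2 * n + 1)"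
      using qbin_theta_scaled[of "\<lambda>m. 3 * m\<^sup>2 - m" "- 1" 0] qbin_theta_scaled[of "\<lambda>m. 3 * m\<^sup>2 + 5 * m + 2" 5 2]
        qbin_theta_odd_F2[of n] qfact_nonzero[of "2 * n + 1"]
      by (simp add: \<beta>_def)
  next
    fix j m :: int
    show "2 * (j * (3 * j - 1) div 2 - m * (21 * m + 11) div 2 - 1)
        = 2 * (3 * m\<^sup>2 - m) + j * (3 * j - 1) - (27 * m\<^sup>2 + 9 * m + 2)"
      by (simp add: twice_exponent power2_eq_square algebra_simps)
    show "2 * (j * (3 * j - 1) div 2 - m * (21 * m + 17) div 2 - 2)
        = 2 * (3 * m\<^sup>2 + 5 * m + 2) + j * (3 * j - 1) - (27 * m\<^sup>2 + 27 * m + 8)"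
      by (simp add: twice_exponent power2_eq_square algebra_simps)
  qed
qed

end

end

section \<open>The case \<open>q = 0\<close>\<close>

text \<open>The difference \<open>E - e - (j - 1)\<close> is \<open>3 (j - 1 - x) (j + x) / 2\<close> with \<open>x = 3 m + d\<close>.\<close>

lemma exponent_ge:
  fixes j m d e E :: int
  assumes "- j - d \<le> 3 * m" "3 * m \<le> j - 1 - d"
    and "2 * E = 2 * e + j * (3 * j - 1) - (3 * (3 * m + d)\<^sup>2 + 3 * (3 * m + d) + 2)"
  shows "E \<ge> e + j - 1"
proof -
  define x where "x = 3 * m + d"
  have "0 \<le> (j - 1 - x) * (j + x)"
    using assms(1,2) by (intro mult_nonneg_nonneg) (auto simp: x_def)
  thus ?thesis
    using assms(3) unfolding x_def[symmetric] by (simp add: power2_eq_square algebra_simps)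
qed

lemma infsum_only_1:
  fixes f :: "int \<Rightarrow> complex"
  assumes "\<And>j. j \<ge> 2 \<Longrightarrow> f j = 0"
  shows "(\<Sum>\<^sub>\<infinity>j\<in>{1..}. f j) = f 1"
proof -
  have "(\<Sum>\<^sub>\<infinity>j\<in>{1..}. f j) = (\<Sum>\<^sub>\<infinity>j\<in>{1}. f j)"
    by (rule infsum_cong_neutral) (use assms in auto)
  thus ?thesis by simp
qed

lemma qpoch_inf_0: "qpoch_inf 0 = 1"
  by (simp add: qpoch_inf_def)

text \<open>Only the term n = 0 survives, with \<open>0 ^ 0 = 1\<close>.\<close>

lemma mock_F0_at_0: "mock_F0 0 = 1"
proof -
  have "mock_F0 0 = (\<Sum>\<^sub>\<infinity>n\<in>{0}. 0 ^ (n\<^sup>2) / qpoch (0 ^ (n + 1)) 0 n)"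
    unfolding mock_F0_def by (rule infsum_cong_neutral) auto
  thus ?thesis by (simp add: qpoch_def)
qed

lemma mock_F1_at_0: "mock_F1 0 = 0"
  unfolding mock_F1_def by (rule infsum_0) auto

lemma mock_F2_at_0: "mock_F2 0 = 1"
proof -
  have "mock_F2 0 = (\<Sum>\<^sub>\<infinity>n\<in>{0}. 0 ^ (n\<^sup>2 + n) / qpoch (0 ^ (n + 1)) 0 (n + 1))"
    unfolding mock_F2_def by (rule infsum_cong_neutral) auto
  thus ?thesis by (simp add: qpoch_def)
qed

lemma zero_powi_exponent:
  fixes j m d e E :: int
  assumes "- j - d \<le> 3 * m" "3 * m \<le> j - 1 - d"
    and "2 * E = 2 * e + j * (3 * j - 1) - (3 * (3 * m + d)\<^sup>2 + 3 * (3 * m + d) + 2)"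
    and "e + j > 1"
  shows "(0 :: complex) powi E = 0"
  using exponent_ge[OF assms(1-3)] assms(4) by simp

text \<open>For j \<ge> 2 the exponent is at least e + j - 1 > 0, and for j = 1 the range contains
  only m = 0. There the exponent equals \<open>e 0\<close>, which decides whether the value is
  zero.\<close>

lemma infsum_0_from_1:
  fixes h c :: "int \<Rightarrow> int \<Rightarrow> complex" and E :: "int \<Rightarrow> int \<Rightarrow> int" and e :: "int \<Rightarrow> int"
  assumes "\<And>m. e m \<ge> 0"
    and "\<And>j m. 2 * E j m = 2 * e m + j * (3 * j - 1) - (27 * m\<^sup>2 + 9 * m + 2)"
  shows "(\<Sum>\<^sub>\<infinity>j\<in>{1..}. \<Sum>m | - j \<le> 3 * m \<and> 3 * m \<le> j - 1. h j m * 0 powi E j m * c j m) =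
    h 1 0 * 0 powi E 1 0 * c 1 0"
proof -
  have "(\<Sum>\<^sub>\<infinity>j\<in>{1..}. \<Sum>m | - j \<le> 3 * m \<and> 3 * m \<le> j - 1. h j m * 0 powi E j m * c j m) =
      (\<Sum>m | - 1 \<le> 3 * m \<and> 3 * m \<le> 1 - 1. h 1 m * 0 powi E 1 m * c 1 m)"
  proof (rule infsum_only_1, rule sum.neutral, safe)
    fix j m :: int assume "j \<ge> 2" "- j \<le> 3 * m" "3 * m \<le> j - 1"
    hence "(0 :: complex) powi E j m = 0"
      using zero_powi_exponent[of j 0 m "E j m" "e m"] assms(1)[of m] assms(2)[of j m] by (simp add: power2_eq_square)
    thus "h j m * 0 powi E j m * c j m = 0" by simp
  qed
  also have "{m::int. - 1 \<le> 3 * m \<and> 3 * m \<le> 1 - 1} = {0}" by auto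
  finally show ?thesis by simp
qed

text \<open>Every term has j \<ge> 2, hence a positive exponent.\<close>

lemma infsum_0_from_2:
  fixes h c :: "int \<Rightarrow> int \<Rightarrow> complex" and E :: "int \<Rightarrow> int \<Rightarrow> int" and e :: "int \<Rightarrow> int"
  assumes "\<And>m. e m \<ge> 0"
    and "\<And>j m. 2 * E j m = 2 * e m + j * (3 * j - 1) - (27 * m\<^sup>2 + 27 * m + 8)"
  shows "(\<Sum>\<^sub>\<infinity>j\<in>{2..}. \<Sum>m | - j - 1 \<le> 3 * m \<and> 3 * m \<le> j - 2. h j m * 0 powi E j m * c j m) = 0"
proof (rule infsum_0)
  fix j :: int assume j: "j \<in> {2..}"
  show "(\<Sum>m | - j - 1 \<le> 3 * m \<and> 3 * m \<le> j - 2. h j m * 0 powi E j m * c j m) = 0"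
  proof (rule sum.neutral, safe)
    fix m assume "- j - 1 \<le> 3 * m" "3 * m \<le> j - 2"
    moreover have "2 * E j m = 2 * e m + j * (3 * j - 1) - (3 * (3 * m + 1)\<^sup>2 + 3 * (3 * m + 1) + 2)"
      unfolding assms(2) by (simp add: power2_eq_square algebra_simps)
    ultimately have "(0 :: complex) powi E j m = 0"
      using zero_powi_exponent[of j 1 m "E j m" "e m"] assms(1)[of m] j by simp
    thus "h j m * 0 powi E j m * c j m = 0" by simp
  qed
qed

theorem theorem1p2:
  fixes q :: complex
  assumes "norm q < 1"
  shows
    "qpoch_inf q * mock_F0 q =
       (\<Sum>\<^sub>\<infinity>j\<in>{1::int..}. \<Sum>m | - j \<le> 3 * m \<and> 3 * m \<le> j - 1.
          sg m * (- 1) powi (m + j + 1) *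
          q powi ((j * (3 * j - 1)) div 2 - (m * (21 * m + 13)) div 2 - 1) *
          (1 + q powi j) * (1 - q powi (6 * m + 1)))
     \<and> qpoch_inf q * mock_F1 q =
       (\<Sum>\<^sub>\<infinity>j\<in>{1::int..}. \<Sum>m | - j \<le> 3 * m \<and> 3 * m \<le> j - 1.
          sg m * (- 1) powi (m + j + 1) *
          q powi ((j * (3 * j - 1)) div 2 - (m * (21 * m + 5)) div 2) *
          (1 + q powi j))
     + (\<Sum>\<^sub>\<infinity>j\<in>{2::int..}. \<Sum>m | - j - 1 \<le> 3 * m \<and> 3 * m \<le> j - 2.
          sg m * (- 1) powi (m + j + 1) *
          q powi ((j * (3 * j - 1)) div 2 - (m * (21 * m + 19)) div 2 - 2) *
          (1 + q powi j))
     \<and> qpoch_inf q * mock_F2 q =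
       (\<Sum>\<^sub>\<infinity>j\<in>{1::int..}. \<Sum>m | - j \<le> 3 * m \<and> 3 * m \<le> j - 1.
          sg m * (- 1) powi (m + j + 1) *
          q powi ((j * (3 * j - 1)) div 2 - (m * (21 * m + 11)) div 2 - 1) *
          (1 + q powi j))
     + (\<Sum>\<^sub>\<infinity>j\<in>{2::int..}. \<Sum>m | - j - 1 \<le> 3 * m \<and> 3 * m \<le> j - 2.
          sg m * (- 1) powi (m + j + 1) *
          q powi ((j * (3 * j - 1)) div 2 - (m * (21 * m + 17)) div 2 - 2) *
          (1 + q powi j))"
proof (cases "q = 0")
  case False
  note q = assms False
  show ?thesis
    by (intro conjI mock_F0_identity[OF q] mock_F1_identity[OF q] mock_F2_identity[OF q])
next
  case True
  \<comment> \<open>The last two factors are grouped into one, as the lemma on sums at zero expects;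
    associativity undoes this at the end.\<close>
  have F0: "(\<Sum>\<^sub>\<infinity>j\<in>{1::int..}. \<Sum>m | - j \<le> 3 * m \<and> 3 * m \<le> j - 1.
      sg m * (- 1) powi (m + j + 1) *
      0 powi ((j * (3 * j - 1)) div 2 - (m * (21 * m + 13)) div 2 - 1) *
      ((1 + 0 powi j) * (1 - 0 powi (6 * m + 1)))) = 1"
    by (subst infsum_0_from_1[where e = "\<lambda>m. 3 * m\<^sup>2 - 2 * m"], rule quadratic_nonneg,
      simp add: twice_exponent power2_eq_square algebra_simps, simp add: sg_def)
  have F1: "(\<Sum>\<^sub>\<infinity>j\<in>{1::int..}. \<Sum>m | - j \<le> 3 * m \<and> 3 * m \<le> j - 1.
      sg m * (- 1) powi (m + j + 1) *
      0 powi ((j * (3 * j - 1)) div 2 - (m * (21 * m + 5)) div 2) * (1 + 0 powi j)) = 0"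
    by (subst infsum_0_from_1[where e = "\<lambda>m. 3 * m\<^sup>2 + 2 * m + 1"], rule quadratic_nonneg)
      (use twice_exponent[of 5 _ _ 0] in \<open>simp_all add: power2_eq_square algebra_simps\<close>)
  have F2: "(\<Sum>\<^sub>\<infinity>j\<in>{1::int..}. \<Sum>m | - j \<le> 3 * m \<and> 3 * m \<le> j - 1.
      sg m * (- 1) powi (m + j + 1) *
      0 powi ((j * (3 * j - 1)) div 2 - (m * (21 * m + 11)) div 2 - 1) * (1 + 0 powi j)) = 1"
    by (subst infsum_0_from_1[where e = "\<lambda>m. 3 * m\<^sup>2 - m"], rule quadratic_nonneg,
      simp add: twice_exponent power2_eq_square algebra_simps, simp add: sg_def)
  have F1': "(\<Sum>\<^sub>\<infinity>j\<in>{2::int..}. \<Sum>m | - j - 1 \<le> 3 * m \<and> 3 * m \<le> j - 2.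
      sg m * (- 1) powi (m + j + 1) *
      0 powi ((j * (3 * j - 1)) div 2 - (m * (21 * m + 19)) div 2 - 2) * (1 + 0 powi j)) = 0"
    by (rule infsum_0_from_2[where e = "\<lambda>m. 3 * m\<^sup>2 + 4 * m + 2"], rule quadratic_nonneg)
      (simp add: twice_exponent power2_eq_square algebra_simps)
  have F2': "(\<Sum>\<^sub>\<infinity>j\<in>{2::int..}. \<Sum>m | - j - 1 \<le> 3 * m \<and> 3 * m \<le> j - 2.
      sg m * (- 1) powi (m + j + 1) *
      0 powi ((j * (3 * j - 1)) div 2 - (m * (21 * m + 17)) div 2 - 2) * (1 + 0 powi j)) = 0"
    by (rule infsum_0_from_2[where e = "\<lambda>m. 3 * m\<^sup>2 + 5 * m + 2"], rule quadratic_nonneg)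
      (simp add: twice_exponent power2_eq_square algebra_simps)
  show ?thesis
    unfolding True qpoch_inf_0 mock_F0_at_0 mock_F1_at_0 mock_F2_at_0 F1 F2 F1' F2'
    using F0 by (simp add: mult.assoc)
qed

end
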